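(* Suppose $(\mathcal C,\mathcal D)$ is a regular MASA inclusion and that $N\subseteq\mathcal N(\mathcal C,\mathcal D)$ is a countable set such that the norm-closed $\mathcal D$-bimodule generated by $N$ is $\mathcal C$. Let $$\mathfrak U:=\{\sigma\in\hat{\mathcal D}:\sigma\text{ has a unique state extension to }\mathcal C\}.$$ Then $\mathfrak U$ is dense in $\hat{\mathcal D}$.
   Context: All $C^*$-algebras are unital. An inclusion is a pair $(\mathcal C,\mathcal D)$ where $\mathcal C$ is a unital $C^*$-algebra and $\mathcal D\subseteq\mathcal C$ is an abelian $C^*$-subalgebra containing the unit of $\mathcal C$. Its normalizers are $\mathcal N(\mathcal C,\mathcal D)=\{v\in\mathcal C: v^*\mathcal Dv\cup v\mathcal Dv^*\subseteq\mathcal D\}$. The inclusion is regular if $\operatorname{span}\mathcal N(\mathcal C,\mathcal D)$ is norm dense in $\mathcal C$, and a MASA inclusion if $\mathcal D$ is a maximal abelian $C^*$-subalgebra of $\mathcal C$; a regular MASA inclusion is both. $\hat{\mathcal D}$ is the space of characters (pure states) of $\mathcal D$ with the weak-$*$ topology. *)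

theory Defs
  imports "HOL-Analysis.Analysis"
begin

text \<open>
  A unital C*-algebra is a type of the class below. The real Banach algebra structure, with
  \<open>norm 1 = 1\<close> (so the zero algebra is excluded), comes from the library classes; the class adds
  a complex scalar multiplication extending the real one and the involution.
\<close>

class cstar_algebra = real_normed_algebra_1 + banach +
  fixes scaleC :: "complex \<Rightarrow> 'a \<Rightarrow> 'a"
    and star :: "'a \<Rightarrow> 'a"
  assumes scaleC_add_right: "scaleC a (x + y) = scaleC a x + scaleC a y"
    and scaleC_add_left: "scaleC (a + b) x = scaleC a x + scaleC b x"
    and scaleC_scaleC: "scaleC a (scaleC b x) = scaleC (a * b) x"
    and scaleC_of_real: "scaleC (complex_of_real r) x = r *\<^sub>R x"
    and mult_scaleC_left: "scaleC a x * y = scaleC a (x * y)"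
    and mult_scaleC_right: "x * scaleC a y = scaleC a (x * y)"
    and norm_scaleC: "norm (scaleC a x) = cmod a * norm x"
    and star_star: "star (star x) = x"
    and star_add: "star (x + y) = star x + star y"
    and star_scaleC: "star (scaleC a x) = scaleC (cnj a) (star x)"
    and star_mult: "star (x * y) = star y * star x"
    and cstar_identity: "norm (star x * x) = (norm x)\<^sup>2"

lemma vector_space_scaleC: "vector_space (scaleC :: complex \<Rightarrow> 'a::cstar_algebra \<Rightarrow> 'a)"
  by unfold_locales
    (use scaleC_of_real[of 1] in
      \<open>auto simp: scaleC_add_right scaleC_add_left scaleC_scaleC\<close>)

abbreviation csubspace :: "'a::cstar_algebra set \<Rightarrow> bool" where
  "csubspace \<equiv> module.subspace scaleC"

abbreviation cspan :: "'a::cstar_algebra set \<Rightarrow> 'a set" where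
  "cspan \<equiv> module.span scaleC"

definition cstar_subalgebra :: "'a::cstar_algebra set \<Rightarrow> bool" where
  "cstar_subalgebra B \<longleftrightarrow> closed B \<and> csubspace B \<and>
     (\<forall>x\<in>B. \<forall>y\<in>B. x * y \<in> B) \<and> (\<forall>x\<in>B. star x \<in> B)"

definition abelian_cstar_subalgebra :: "'a::cstar_algebra set \<Rightarrow> bool" where
  "abelian_cstar_subalgebra B \<longleftrightarrow> cstar_subalgebra B \<and> (\<forall>x\<in>B. \<forall>y\<in>B. x * y = y * x)"

text \<open>In an inclusion \<open>(C, D)\<close>, the algebra \<open>C\<close> is the whole type and \<open>D\<close> is a subset.\<close>

definition inclusion :: "'a::cstar_algebra set \<Rightarrow> bool" where
  "inclusion D \<longleftrightarrow> abelian_cstar_subalgebra D \<and> 1 \<in> D"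

definition normalizers :: "'a::cstar_algebra set \<Rightarrow> 'a set" where
  "normalizers D = {v. \<forall>d\<in>D. star v * d * v \<in> D \<and> v * d * star v \<in> D}"

definition regular_inclusion :: "'a::cstar_algebra set \<Rightarrow> bool" where
  "regular_inclusion D \<longleftrightarrow> inclusion D \<and> closure (cspan (normalizers D)) = UNIV"

definition masa_inclusion :: "'a::cstar_algebra set \<Rightarrow> bool" where
  "masa_inclusion D \<longleftrightarrow> inclusion D \<and>
     (\<forall>B. abelian_cstar_subalgebra B \<and> D \<subseteq> B \<longrightarrow> B = D)"

definition regular_masa_inclusion :: "'a::cstar_algebra set \<Rightarrow> bool" where
  "regular_masa_inclusion D \<longleftrightarrow> regular_inclusion D \<and> masa_inclusion D"

definition sub_bimodule :: "'a::cstar_algebra set \<Rightarrow> 'a set \<Rightarrow> bool" where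
  "sub_bimodule D M \<longleftrightarrow> csubspace M \<and> (\<forall>d\<in>D. \<forall>m\<in>M. d * m \<in> M \<and> m * d \<in> M)"

definition closed_bimodule_generated :: "'a::cstar_algebra set \<Rightarrow> 'a set \<Rightarrow> 'a set" where
  "closed_bimodule_generated D N = (\<lambda>M. closed M \<and> sub_bimodule D M) hull N"

text \<open>
  Characters are the nonzero multiplicative linear functionals on \<open>D\<close>. A functional on \<open>D\<close> is
  encoded as an extensional function, i.e. one with the value \<open>undefined\<close> outside \<open>D\<close>, so that
  equality of such functions is equality on \<open>D\<close>.
\<close>

definition characters :: "'a::cstar_algebra set \<Rightarrow> ('a \<Rightarrow> complex) set" where
  "characters D = {\<sigma> \<in> extensional D.
     (\<forall>x\<in>D. \<forall>y\<in>D. \<sigma> (x + y) = \<sigma> x + \<sigma> y) \<and>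
     (\<forall>a. \<forall>x\<in>D. \<sigma> (scaleC a x) = a * \<sigma> x) \<and>
     (\<forall>x\<in>D. \<forall>y\<in>D. \<sigma> (x * y) = \<sigma> x * \<sigma> y) \<and>
     (\<exists>x\<in>D. \<sigma> x \<noteq> 0)}"

text \<open>The weak-* topology is the topology of pointwise convergence on \<open>D\<close>.\<close>

definition character_space :: "'a::cstar_algebra set \<Rightarrow> ('a \<Rightarrow> complex) topology" where
  "character_space D = subtopology (product_topology (\<lambda>_. euclidean) D) (characters D)"

lemma topspace_character_space: "topspace (character_space D) = characters D"
  by (auto simp: character_space_def characters_def PiE_def)

definition state :: "('a::cstar_algebra \<Rightarrow> complex) \<Rightarrow> bool" where
  "state \<phi> \<longleftrightarrow> Vector_Spaces.linear scaleC (*) \<phi> \<and>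
     (\<forall>x. \<phi> (star x * x) \<in> \<real>\<^sub>\<ge>\<^sub>0) \<and> \<phi> 1 = 1"

definition unique_extension_characters :: "'a::cstar_algebra set \<Rightarrow> ('a \<Rightarrow> complex) set" where
  "unique_extension_characters D =
     {\<sigma> \<in> characters D. \<exists>!\<phi>. state \<phi> \<and> (\<forall>d\<in>D. \<phi> d = \<sigma> d)}"

end

theory Submission
  imports Defs
begin

text \<open>
  Every state extending a character \<open>\<sigma>\<close> of \<open>D\<close> is multiplicative against \<open>D\<close>, so it is determined by
  its values on \<open>N\<close>. For a normalizer \<open>v\<close> let \<open>G v\<close> be the closed set of characters fixed by the partial
  homeomorphism \<open>\<sigma> \<mapsto> \<sigma>(v\<^sup>* \<cdot> v) / \<sigma>(v\<^sup>* v)\<close>, or outside its domain. Off \<open>G v\<close> every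
  extension vanishes at \<open>v\<close>. At an interior point \<open>\<sigma>\<close> of \<open>G v\<close> there is \<open>d \<in> D\<close> supported in \<open>G v\<close>
  with \<open>\<sigma> d \<noteq> 0\<close>; then \<open>v d\<close> commutes with \<open>D\<close>, hence lies in the MASA \<open>D\<close>, and the value at \<open>v\<close> is
  forced. So the characters without a unique extension lie in the countable union over \<open>v \<in> N\<close> of the
  nowhere dense boundaries of \<open>G v\<close>, and the Baire category theorem applies.

  Gelfand duality is obtained without spectral theory: positivity is defined by a norm condition, square
  roots come from the binomial series, and a character attaining the norm is read off a maximal
  preordering of the self-adjoint part, as in the Positivstellensatz.
\<close>

subsection \<open>Involution and norm\<close>

text \<open>States are tested on hermitian squares of the whole algebra, whereas characters only see
  an abelian subalgebra. The bridge is positivity of \<open>star x * x\<close>, which is not among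
  the C*-axioms. It is needed for the existence of even one extension, because the functional
  delivered by Hahn-Banach is only known to be contractive. Its proof applies the duality to the
  bicommutant of a single self-adjoint element, so the Gelfand theory is developed for an arbitrary
  abelian inclusion and not just for the MASA.

  Characters cannot be evaluated at \<open>v * d\<close> before it is known to lie in
  \<open>D\<close>. What can be evaluated is \<open>star x * x\<close> for a commutator
  \<open>x\<close> of \<open>v * d\<close> with an element of \<open>D\<close>: the normalizer
  property puts all four terms of its expansion in \<open>D\<close>, and the C*-identity turns
  vanishing at every character into \<open>x = 0\<close>.

  At a boundary point of \<open>G v\<close> neither way of pinning down the value at
  \<open>v\<close> is available.\<close>

interpretation scaleC: vector_space "scaleC :: complex \<Rightarrow> 'a::cstar_algebra \<Rightarrow> 'a"
  by (rule vector_space_scaleC)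

lemma of_real_mult_commute: "of_real r * x = x * (of_real r :: 'a::real_normed_algebra_1)"
  by (metis mult_scaleR_right mult.right_neutral scaleR_conv_of_real)

lemma of_real_mult_left_commute:
  "x * (of_real r * y) = of_real r * (x * (y :: 'a::real_normed_algebra_1))"
  by (metis mult.assoc of_real_mult_commute)

lemma star_scaleR: "star (r *\<^sub>R x) = r *\<^sub>R star (x :: 'a::cstar_algebra)"
  by (metis complex_cnj_complex_of_real scaleC_of_real star_scaleC)

lemma norm_star [simp]: "norm (star x) = norm (x :: 'a::cstar_algebra)"
proof -
  have "norm y \<le> norm (star y)" for y :: 'a
  proof (cases "y = 0")
    case False
    have "norm y * norm y \<le> norm (star y) * norm y"
      using norm_mult_ineq[of "star y" y] by (simp add: cstar_identity power2_eq_square)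
    then show ?thesis using False by simp
  qed auto
  from this[of x] this[of "star x"] show ?thesis by (simp add: star_star)
qed

lemma bounded_linear_star: "bounded_linear (star :: 'a::cstar_algebra \<Rightarrow> 'a)"
  by (rule bounded_linear_intro[of _ 1]) (auto simp: star_add star_scaleR)

lemma star_0 [simp]: "star (0::'a::cstar_algebra) = 0"
  by (rule linear_simps(3)[OF bounded_linear_star])

lemma star_minus [simp]: "star (- x) = - star (x::'a::cstar_algebra)"
  by (rule linear_simps(4)[OF bounded_linear_star])

lemma star_diff: "star (x - y) = star x - star (y::'a::cstar_algebra)"
  by (rule linear_simps(2)[OF bounded_linear_star])

lemma star_1 [simp]: "star (1::'a::cstar_algebra) = 1"
  by (metis mult_1_left mult_1_right star_mult star_star)

lemma star_of_real [simp]: "star (of_real r :: 'a::cstar_algebra) = of_real r"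
  by (simp add: of_real_def star_scaleR)

lemma star_power: "star (x ^ n) = star (x::'a::cstar_algebra) ^ n"
  by (induction n) (auto simp: star_mult power_commutes)

lemmas star_simps = star_add star_diff star_mult star_scaleR star_scaleC star_star

lemma of_real_eq_scaleC: "(of_real r :: 'a::cstar_algebra) = scaleC (complex_of_real r) 1"
  by (metis scaleC_of_real scaleR_conv_of_real mult.right_neutral)

lemma norm_square_sa: "star x = x \<Longrightarrow> norm (x * x) = (norm (x::'a::cstar_algebra))\<^sup>2"
  using cstar_identity[of x] by simp

lemma norm_sa_add_i:
  fixes h k :: "'a::cstar_algebra"
  assumes "star h = h" "star k = k" "h * k = k * h"
  shows "(norm (h + scaleC \<i> k))\<^sup>2 = norm (h * h + k * k)"
proof -
  have "star (h + scaleC \<i> k) * (h + scaleC \<i> k) = h * h + k * k"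
    using assms
    by (simp add: star_simps algebra_simps mult_scaleC_left mult_scaleC_right scaleC_scaleC scaleC.scale_minus_left)
  then show ?thesis using cstar_identity[of "h + scaleC \<i> k"] by simp
qed

text \<open>\<open>h\<close> is the real part of \<open>z = h + scaleC \<i> k\<close>, hence not
  larger in norm, and the C*-identity computes the square of \<open>norm z\<close>. This stands in
  for monotonicity of the norm before any order is available.\<close>

lemma norm_le_norm_sum_squares:
  fixes h k :: "'a::cstar_algebra"
  assumes "star h = h" "star k = k" "h * k = k * h"
  shows "norm (h * h) \<le> norm (h * h + k * k)"
proof -
  let ?z = "h + scaleC \<i> k"
  have "?z + star ?z = 2 *\<^sub>R h"
    using assms by (simp add: star_simps scaleC.scale_minus_left scaleR_2)
  then have "2 * norm h \<le> norm ?z + norm ?z"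
    by (metis abs_numeral norm_scaleR norm_star norm_triangle_ineq)
  then have "(norm h)\<^sup>2 \<le> (norm ?z)\<^sup>2" by simp
  then show ?thesis using norm_sa_add_i[OF assms] norm_square_sa assms by metis
qed

lemma sa_parts:
  fixes x :: "'a::cstar_algebra"
  shows "star ((1/2) *\<^sub>R (x + star x)) = (1/2) *\<^sub>R (x + star x)"
    and "star (scaleC (- \<i> / 2) (x - star x)) = scaleC (- \<i> / 2) (x - star x)"
    and "(1/2) *\<^sub>R (x + star x) + scaleC \<i> (scaleC (- \<i> / 2) (x - star x)) = x"
proof -
  show "star ((1/2) *\<^sub>R (x + star x)) = (1/2) *\<^sub>R (x + star x)"
    by (simp add: star_simps add.commute)
  show "star (scaleC (- \<i> / 2) (x - star x)) = scaleC (- \<i> / 2) (x - star x)"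
    by (simp add: star_simps scaleC.scale_right_diff_distrib scaleC.scale_minus_left)
  have "scaleC \<i> (scaleC (- \<i> / 2) (x - star x)) = scaleC (complex_of_real (1/2)) (x - star x)"
    by (simp add: scaleC_scaleC)
  also have "\<dots> = (1/2) *\<^sub>R (x - star x)" by (rule scaleC_of_real)
  finally have "(1/2) *\<^sub>R (x + star x) + scaleC \<i> (scaleC (- \<i> / 2) (x - star x))
      = (1/2) *\<^sub>R x + (1/2) *\<^sub>R x"
    by (simp add: algebra_simps)
  then show "(1/2) *\<^sub>R (x + star x) + scaleC \<i> (scaleC (- \<i> / 2) (x - star x)) = x"
    by (simp flip: scaleR_add_left)
qed

lemma sa_decomposition_unique:
  fixes a b c d :: "'a::cstar_algebra"
  assumes "star a = a" "star b = b" "star c = c" "star d = d"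
    and eq: "a + scaleC \<i> b = c + scaleC \<i> d"
  shows "a = c \<and> b = d"
proof -
  have "star (p + scaleC \<i> q) = p - scaleC \<i> q" if "star p = p" "star q = q" for p q :: 'a
    using that by (simp add: star_simps)
  then have eq': "a - scaleC \<i> b = c - scaleC \<i> d" using assms by metis
  have "a + a = (a + scaleC \<i> b) + (a - scaleC \<i> b)" by simp
  also have "\<dots> = c + c" unfolding eq eq' by simp
  finally have "a = c" by (simp flip: scaleR_2)
  with eq have "scaleC \<i> b = scaleC \<i> d" by simp
  then show ?thesis using \<open>a = c\<close> by (simp add: scaleC.scale_cancel_left)
qed

text \<open>Real scalars and no involution: exactly what power series with real coefficients
  preserve. Commutants of arbitrary sets qualify, so a single membership statement about roots also
  yields their commutation properties.\<close>

definition closed_subalgebra :: "'a::cstar_algebra set \<Rightarrow> bool" where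
  "closed_subalgebra B \<longleftrightarrow> closed B \<and> subspace B \<and> 1 \<in> B \<and> (\<forall>x\<in>B. \<forall>y\<in>B. x * y \<in> B)"

lemma closed_subalgebra_power: "closed_subalgebra B \<Longrightarrow> x \<in> B \<Longrightarrow> x ^ n \<in> B"
  by (induction n) (auto simp: closed_subalgebra_def)

lemma closed_subalgebra_suminf:
  assumes "closed_subalgebra B" "summable f" "\<And>n. f n \<in> B"
  shows "suminf f \<in> B"
proof -
  have "closed B" "\<And>n. (\<Sum>i<n. f i) \<in> B"
    using assms(1,3) by (auto simp: closed_subalgebra_def intro!: subspace_sum)
  then show ?thesis
    using summable_LIMSEQ[OF assms(2)] by (rule closed_sequentially)
qed

lemma closed_subalgebra_commutant: "closed_subalgebra {y. \<forall>x\<in>S. x * y = y * x}"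
proof -
  have "closed {y::'a. \<forall>x\<in>S. x * y = y * x}"
    unfolding Ball_def
    by (intro closed_Collect_all closed_Collect_imp open_Collect_const closed_Collect_eq continuous_intros)
  then show ?thesis
    unfolding closed_subalgebra_def subspace_def
    by (auto simp: algebra_simps) (metis mult.assoc)
qed

lemma neumann_inverse:
  fixes z :: "'a::cstar_algebra"
  assumes "closed_subalgebra B" "z \<in> B" "norm z < 1"
  obtains s where "s \<in> B" "(1 - z) * s = 1" "s * (1 - z) = 1"
proof
  let ?s = "\<Sum>n. z ^ n"
  have sm: "summable (\<lambda>n. z ^ n)" using assms(3) by (rule complete_algebra_summable_geometric)
  show "?s \<in> B"
    using assms sm by (intro closed_subalgebra_suminf closed_subalgebra_power)
  have split: "?s = 1 + (\<Sum>n. z ^ Suc n)"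
    using suminf_split_head[OF sm] by (simp add: algebra_simps)
  have "(\<Sum>n. z ^ Suc n) = z * ?s" using suminf_mult[OF sm, of z] by simp
  then show "(1 - z) * ?s = 1" using split by (simp add: algebra_simps)
  have "(\<Sum>n. z ^ Suc n) = ?s * z"
    using suminf_mult2[OF sm, of z] by (simp add: power_commutes)
  then show "?s * (1 - z) = 1" using split by (simp add: algebra_simps)
qed

subsection \<open>Square roots and positivity\<close>

text \<open>The Taylor coefficients of sqrt (1 - x) at 0.\<close>

definition sqrt_coeff :: "nat \<Rightarrow> real" where
  "sqrt_coeff n = (1/2 gchoose n) * (- 1) ^ n"

lemma sqrt_coeff_0 [simp]: "sqrt_coeff 0 = 1"
  by (simp add: sqrt_coeff_def)

text \<open>These are the coefficients of (1 - x) to the power -1/2. They serve twice: up to a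
  negative factor depending on the degree they are the higher coefficients of sqrt (1 - x), and they
  are also the partial sums of those coefficients.\<close>

lemma neg_half_gbinomial_pos: "(- 1) ^ n * ((- 1/2 :: real) gchoose n) > 0"
proof (induction n)
  case (Suc n)
  have "real (Suc n) * ((- 1/2 :: real) gchoose Suc n) = - (1/2 + n) * ((- 1/2) gchoose n)"
    using gbinomial_mult_1[of "-1/2::real" n] by (simp add: algebra_simps)
  moreover have "N * X = - c * Y \<Longrightarrow> N * ((- 1 * Z) * X) = c * (Z * Y)" for N X Y Z c :: real
    by algebra
  ultimately have "real (Suc n) * ((- 1) ^ Suc n * ((- 1/2 :: real) gchoose Suc n))
      = (1/2 + n) * ((- 1) ^ n * ((- 1/2) gchoose n))"
    unfolding power_Suc by blast
  also have "\<dots> > 0" by (intro mult_pos_pos[OF _ Suc]) (auto intro: add_pos_nonneg)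
  finally show ?case by (rule zero_less_mult_pos) simp
qed simp

lemma sqrt_coeff_nonpos: "sqrt_coeff (Suc n) \<le> 0"
proof -
  have "sqrt_coeff (Suc n) = - (1/2 / Suc n) * ((- 1) ^ n * ((- 1/2) gchoose n))"
    using gbinomial_absorption'[of "Suc n" "1/2::real"] by (simp add: sqrt_coeff_def)
  moreover have "0 \<le> (1/2 / Suc n) * ((- 1) ^ n * ((- 1/2 :: real) gchoose n))"
    using neg_half_gbinomial_pos[of n] by (intro mult_nonneg_nonneg[OF _ less_imp_le]) auto
  ultimately show ?thesis by simp
qed

text \<open>The coefficients begin with 1 and are nonpositive afterwards, so positivity of their
  partial sums bounds the absolute values. The exact bound 1 matters for
  \<open>norm_one_minus_sqrt\<close>.\<close>

lemma sum_abs_sqrt_coeff: "(\<Sum>k<n. \<bar>sqrt_coeff (Suc k)\<bar>) \<le> 1"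
proof -
  have "(\<Sum>k\<le>n. sqrt_coeff k) > 0"
    using gbinomial_sum_lower_neg[of "1/2::real" n] neg_half_gbinomial_pos[of n]
    by (simp add: sqrt_coeff_def)
  moreover have "(\<Sum>k\<le>n. sqrt_coeff k) = 1 - (\<Sum>k<n. \<bar>sqrt_coeff (Suc k)\<bar>)"
    by (subst sum.atMost_shift) (simp add: sqrt_coeff_nonpos abs_of_nonpos sum_negf)
  ultimately show ?thesis by linarith
qed

text \<open>Vandermonde with 1/2 + 1/2 = 1: the Cauchy square of the series has the coefficients of
  1 - x.\<close>

lemma sqrt_coeff_convolution:
  "(\<Sum>i\<le>n. sqrt_coeff i * sqrt_coeff (n - i)) = (if n = 0 then 1 else if n = 1 then - 1 else 0)"
proof -
  have "(\<Sum>i\<le>n. sqrt_coeff i * sqrt_coeff (n - i))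
      = (\<Sum>i\<le>n. (- 1) ^ n * ((1/2 gchoose i) * (1/2 gchoose (n - i))))"
  proof (rule sum.cong)
    fix i assume "i \<in> {..n}"
    then have "(- 1::real) ^ n = (- 1) ^ i * (- 1) ^ (n - i)" by (simp flip: power_add)
    then show "sqrt_coeff i * sqrt_coeff (n - i) = (- 1) ^ n * ((1/2 gchoose i) * (1/2 gchoose (n - i)))"
      by (simp add: sqrt_coeff_def)
  qed simp
  also have "\<dots> = (- 1) ^ n * (1 gchoose n)"
    using gbinomial_Vandermonde[of "1/2::real" "1/2" n]
    by (simp add: sum_distrib_left[symmetric] atLeast0AtMost)
  also have "(1 gchoose n) = real (1 choose n)" by (simp add: binomial_gbinomial)
  finally show ?thesis by (cases n; cases "n - 1") (auto simp: binomial_eq_0)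
qed

definition sqrt_one_minus :: "'a::cstar_algebra \<Rightarrow> 'a" where
  "sqrt_one_minus x = (\<Sum>n. sqrt_coeff n *\<^sub>R x ^ n)"

lemma summable_abs_sqrt_coeff: "summable (\<lambda>n. \<bar>sqrt_coeff n\<bar>)"
proof -
  have "summable (\<lambda>n. \<bar>sqrt_coeff (Suc n)\<bar>)"
    by (rule summableI_nonneg_bounded[of _ 1]) (auto simp: sum_abs_sqrt_coeff)
  then show ?thesis by (subst (asm) summable_Suc_iff)
qed

lemma norm_sqrt_term:
  "norm x \<le> 1 \<Longrightarrow> norm (sqrt_coeff n *\<^sub>R (x::'a::cstar_algebra) ^ n) \<le> \<bar>sqrt_coeff n\<bar>"
  using norm_power_ineq[of x n] power_le_one[of "norm x" n]
  by (simp add: mult_left_le)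

lemma summable_norm_sqrt:
  "norm x \<le> 1 \<Longrightarrow> summable (\<lambda>n. norm (sqrt_coeff n *\<^sub>R (x::'a::cstar_algebra) ^ n))"
  by (rule summable_comparison_test[OF _ summable_abs_sqrt_coeff])
    (use norm_sqrt_term in auto)

lemma sqrt_one_minus_square:
  assumes "norm x \<le> 1"
  shows "sqrt_one_minus x * sqrt_one_minus x = 1 - (x::'a::cstar_algebra)"
proof -
  have "sqrt_one_minus x * sqrt_one_minus x
      = (\<Sum>k. \<Sum>i\<le>k. (sqrt_coeff i *\<^sub>R x ^ i) * (sqrt_coeff (k - i) *\<^sub>R x ^ (k - i)))"
    unfolding sqrt_one_minus_def using assms by (intro Cauchy_product summable_norm_sqrt)
  also have "\<dots> = (\<Sum>k. (if k = 0 then 1 else if k = 1 then - 1 else 0) *\<^sub>R x ^ k)"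
  proof (intro suminf_cong)
    fix k
    have "(\<Sum>i\<le>k. (sqrt_coeff i *\<^sub>R x ^ i) * (sqrt_coeff (k - i) *\<^sub>R x ^ (k - i)))
        = (\<Sum>i\<le>k. (sqrt_coeff i * sqrt_coeff (k - i)) *\<^sub>R x ^ k)"
      by (rule sum.cong) (auto simp flip: power_add simp: mult.commute)
    then show "(\<Sum>i\<le>k. (sqrt_coeff i *\<^sub>R x ^ i) * (sqrt_coeff (k - i) *\<^sub>R x ^ (k - i)))
        = (if k = 0 then 1 else if k = 1 then - 1 else 0) *\<^sub>R x ^ k"
      by (simp only: sqrt_coeff_convolution flip: scaleR_sum_left)
  qed
  also have "\<dots> = (\<Sum>k\<in>{0,1}. (if k = 0 then 1 else if k = 1 then - 1 else 0) *\<^sub>R x ^ k)"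
    by (rule suminf_finite) auto
  also have "\<dots> = 1 - x" by simp
  finally show ?thesis .
qed

text \<open>Allows the construction to be iterated: the root is itself of the form 1 - y with
  \<open>norm y \<le> 1\<close>, so it has a root too.\<close>

lemma norm_one_minus_sqrt:
  assumes "norm x \<le> 1"
  shows "norm (1 - sqrt_one_minus (x::'a::cstar_algebra)) \<le> 1"
proof -
  have "sqrt_one_minus x = 1 + (\<Sum>n. sqrt_coeff (Suc n) *\<^sub>R x ^ Suc n)"
    using suminf_split_head[OF summable_norm_cancel[OF summable_norm_sqrt[OF assms]]]
    by (simp add: sqrt_one_minus_def algebra_simps)
  then have "norm (1 - sqrt_one_minus x) = norm (\<Sum>n. sqrt_coeff (Suc n) *\<^sub>R x ^ Suc n)"
    by simp
  also have "\<dots> \<le> (\<Sum>n. \<bar>sqrt_coeff (Suc n)\<bar>)"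
  proof (rule norm_suminf_le)
    show "norm (sqrt_coeff (Suc n) *\<^sub>R x ^ Suc n) \<le> \<bar>sqrt_coeff (Suc n)\<bar>" for n
      using assms by (rule norm_sqrt_term)
    show "summable (\<lambda>n. \<bar>sqrt_coeff (Suc n)\<bar>)"
      using summable_abs_sqrt_coeff by (subst summable_Suc_iff)
  qed
  also have "\<dots> \<le> 1"
    using summable_abs_sqrt_coeff
    by (intro suminf_le_const sum_abs_sqrt_coeff) (subst summable_Suc_iff)
  finally show ?thesis .
qed

lemma star_sqrt_one_minus:
  assumes "norm x \<le> 1" "star x = x"
  shows "star (sqrt_one_minus x) = sqrt_one_minus (x::'a::cstar_algebra)"
  unfolding sqrt_one_minus_def
  using bounded_linear.suminf[OF bounded_linear_star
      summable_norm_cancel[OF summable_norm_sqrt[OF assms(1)]]] assms(2)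
  by (simp add: star_scaleR star_power)

lemma sqrt_one_minus_in:
  assumes "norm x \<le> 1" "closed_subalgebra B" "x \<in> B"
  shows "sqrt_one_minus x \<in> B"
  unfolding sqrt_one_minus_def
  using assms summable_norm_cancel[OF summable_norm_sqrt[OF assms(1)]]
  by (intro closed_subalgebra_suminf)
    (auto simp: closed_subalgebra_power closed_subalgebra_def intro!: subspace_scale)

text \<open>
  This norm condition says that the spectrum of a self-adjoint element is nonnegative. Unlike the
  condition \<open>a = x\<^sup>* x\<close>, it is visibly stable under sums.
\<close>

definition cpositive :: "'a::cstar_algebra \<Rightarrow> bool" where
  "cpositive a \<longleftrightarrow> star a = a \<and> norm (of_real (norm a) - a) \<le> norm a"

text \<open>After scaling to norm one, 1 - g^2 has a self-adjoint root \<open>k\<close>, which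
  commutes with \<open>g\<close> because the commutant of \<open>g\<close> is a closed subalgebra.
  Then \<open>norm (k * k) \<le> norm (k * k + g * g)\<close>, and the sum on the right is
  1.\<close>

lemma cpositive_square:
  fixes h :: "'a::cstar_algebra"
  assumes "star h = h"
  shows "cpositive (h * h)"
proof (cases "h = 0")
  case False
  define g where "g = (1 / norm h) *\<^sub>R h"
  have g: "star g = g" "norm g = 1" using assms False by (auto simp: g_def star_scaleR)
  then have ngg: "norm (g * g) = 1" by (simp add: norm_square_sa)
  define k where "k = sqrt_one_minus (g * g)"
  have k: "star k = k" "k * k = 1 - g * g"
    unfolding k_def using g ngg
    by (auto simp: star_sqrt_one_minus star_mult sqrt_one_minus_square)
  have "k \<in> {y. \<forall>x\<in>{g}. x * y = y * x}"
    unfolding k_def using ngg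
    by (intro sqrt_one_minus_in closed_subalgebra_commutant) (auto simp: mult.assoc)
  then have "norm (k * k) \<le> norm (k * k + g * g)"
    using g k by (intro norm_le_norm_sum_squares) auto
  then have *: "norm (1 - g * g) \<le> 1" by (simp add: k)
  have "of_real (norm (h * h)) - h * h = (norm h)\<^sup>2 *\<^sub>R (1 - g * g)"
    using assms False
    by (simp add: norm_square_sa g_def algebra_simps power2_eq_square of_real_def)
  then show ?thesis
    using * assms by (simp add: cpositive_def norm_square_sa star_mult mult_left_le)
qed (simp add: cpositive_def)

text \<open>The radius is arbitrary instead of \<open>norm a\<close>, so that
  \<open>cpositive_iff\<close> can free positivity from a particular radius. The last conclusion
  keeps roots inside a given abelian algebra and makes them commute with whatever commutes with
  \<open>a\<close>.\<close>

lemma cpositive_sqrt: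
  fixes a :: "'a::cstar_algebra"
  assumes "star a = a" "norm (of_real r - a) \<le> r"
  obtains s where "cpositive s" "s * s = a" "\<And>B. closed_subalgebra B \<Longrightarrow> a \<in> B \<Longrightarrow> s \<in> B"
proof (cases "r = 0")
  case True
  with assms have "a = 0" by simp
  show ?thesis
    by (rule that[of 0]) (auto simp: \<open>a = 0\<close> cpositive_def closed_subalgebra_def subspace_def)
next
  case False
  then have r: "r > 0" using assms(2) norm_ge_zero[of "of_real r - a"] by linarith
  define x where "x = 1 - (1 / r) *\<^sub>R a"
  have "x = (1 / r) *\<^sub>R (of_real r - a)" using r by (simp add: x_def algebra_simps of_real_def)
  then have "norm x = norm (of_real r - a) / r" using r by simp
  then have x: "norm x \<le> 1" "star x = x" using assms r
    by (auto simp: x_def star_simps)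
  define q where "q = sqrt_one_minus x"
  define s where "s = sqrt r *\<^sub>R q"
  have q: "star q = q" "norm (1 - q) \<le> 1" "q * q = 1 - x"
    using x by (auto simp: q_def star_sqrt_one_minus norm_one_minus_sqrt sqrt_one_minus_square)
  have ss: "s * s = a" using r q(3) by (simp add: s_def x_def)
  have sa: "star s = s" by (simp add: s_def star_scaleR q)
  \<comment> \<open>Being a multiple of q = 1 - (1 - q) with 1 - q in the unit ball,
    \<open>s\<close> has a self-adjoint root itself, and squares are already known to be
    positive.\<close>
  have "\<exists>p. star p = p \<and> s = p * p"
  proof -
    define p where "p = sqrt (sqrt r) *\<^sub>R sqrt_one_minus (1 - q)"
    have "star p = p" using q by (simp add: p_def star_scaleR star_sqrt_one_minus star_diff)
    moreover have "p * p = s" using q r by (simp add: p_def sqrt_one_minus_square s_def)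
    ultimately show ?thesis by metis
  qed
  then have pos: "cpositive s" using cpositive_square by auto
  show ?thesis
  proof (rule that[OF pos ss])
    fix B :: "'a set" assume B: "closed_subalgebra B" "a \<in> B"
    then have "x \<in> B" by (auto simp: x_def closed_subalgebra_def intro!: subspace_diff subspace_scale)
    then show "s \<in> B" using B x(1)
      by (auto simp: s_def q_def sqrt_one_minus_in closed_subalgebra_def intro!: subspace_scale)
  qed
qed

lemma cpositive_iff: "cpositive (a::'a::cstar_algebra) \<longleftrightarrow> star a = a \<and> (\<exists>r. norm (of_real r - a) \<le> r)"
proof
  assume "star a = a \<and> (\<exists>r. norm (of_real r - a) \<le> r)"
  then obtain r where a: "star a = a" "norm (of_real r - a) \<le> r" by auto
  obtain s where "cpositive s" "s * s = a"
    using cpositive_sqrt[OF a] by blast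
  then show "cpositive a" using cpositive_square[of s] by (auto simp: cpositive_def)
qed (auto simp: cpositive_def)

lemma cpositive_star: "cpositive a \<Longrightarrow> star a = a"
  by (simp add: cpositive_def)

lemma cpositive_obtain_sqrt:
  fixes a :: "'a::cstar_algebra"
  assumes "cpositive a"
  obtains s where "cpositive s" "s * s = a" "\<And>B. closed_subalgebra B \<Longrightarrow> a \<in> B \<Longrightarrow> s \<in> B"
  using assms cpositive_sqrt[of a] unfolding cpositive_def by metis

lemma cpositive_of_real [simp]: "r \<ge> 0 \<Longrightarrow> cpositive (of_real r :: 'a::cstar_algebra)"
  by (simp add: cpositive_def)

lemma cpositive_add:
  assumes "cpositive a" "cpositive b" shows "cpositive (a + (b::'a::cstar_algebra))"
proof -
  have "norm (of_real (norm a + norm b) - (a + b))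
      \<le> norm (of_real (norm a) - a) + norm (of_real (norm b) - b)"
    by (rule order_trans[OF _ norm_triangle_ineq]) (simp add: algebra_simps)
  also have "\<dots> \<le> norm a + norm b" using assms by (auto simp: cpositive_def)
  finally show ?thesis
    using assms unfolding cpositive_iff by (intro conjI exI[of _ "norm a + norm b"]) (auto simp: star_add)
qed

lemma cpositive_scaleR:
  assumes "cpositive a" "r \<ge> 0" shows "cpositive (r *\<^sub>R (a::'a::cstar_algebra))"
proof -
  have "of_real (norm (r *\<^sub>R a)) - r *\<^sub>R a = r *\<^sub>R (of_real (norm a) - a)"
    using assms by (simp add: algebra_simps of_real_def)
  then show ?thesis using assms by (auto simp: cpositive_def star_scaleR mult_left_mono)
qed

text \<open>The root \<open>s\<close> of \<open>a\<close> lies in the commutant of \<open>b\<close>;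
  hence the root \<open>t\<close> of \<open>b\<close> lies in the commutant of \<open>s\<close>. So
  the product is the square of the self-adjoint \<open>s * t\<close>.\<close>

lemma cpositive_mult:
  fixes a b :: "'a::cstar_algebra"
  assumes "cpositive a" "cpositive b" "a * b = b * a"
  shows "cpositive (a * b)"
proof -
  obtain s where s: "cpositive s" "s * s = a" "\<And>B. closed_subalgebra B \<Longrightarrow> a \<in> B \<Longrightarrow> s \<in> B"
    using cpositive_obtain_sqrt[OF assms(1)] by metis
  obtain t where t: "cpositive t" "t * t = b" "\<And>B. closed_subalgebra B \<Longrightarrow> b \<in> B \<Longrightarrow> t \<in> B"
    using cpositive_obtain_sqrt[OF assms(2)] by metis
  have "s \<in> {y. \<forall>x\<in>{b}. x * y = y * x}"
    using assms by (intro s closed_subalgebra_commutant) auto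
  then have "t \<in> {y. \<forall>x\<in>{s}. x * y = y * x}"
    by (intro t closed_subalgebra_commutant) auto
  then have st: "s * t = t * s" by simp
  then have "(s * t) * (s * t) = a * b" unfolding s(2)[symmetric] t(2)[symmetric]
    by (metis mult.assoc)
  moreover have "star (s * t) = s * t" using st s t by (simp add: star_mult cpositive_star)
  ultimately show ?thesis using cpositive_square by metis
qed

lemma cpositive_of_real_minus: "star a = a \<Longrightarrow> norm a \<le> r \<Longrightarrow> cpositive (of_real r - (a::'a::cstar_algebra))"
  unfolding cpositive_iff by (auto simp: star_diff intro!: exI[of _ r])

lemma cpositive_of_real_plus: "star a = a \<Longrightarrow> norm a \<le> r \<Longrightarrow> cpositive (of_real r + (a::'a::cstar_algebra))"
  using cpositive_of_real_minus[of "- a" r] by simp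

subsection \<open>Gelfand theory\<close>

text \<open>Translation by i t moves the imaginary part of \<open>c\<close> by t, while the squared
  norm of \<open>h\<close> grows by at most t^2; the cross term 2 t Im c has nothing to balance it.
  Stated for a bare number \<open>c\<close> to cover both characters and contractive functionals on
  the whole algebra.\<close>

lemma sa_real_of_norm_bound:
  fixes h :: "'a::cstar_algebra"
  assumes h: "star h = h"
    and bound: "\<And>t::real. cmod (c + \<i> * of_real t) \<le> norm (h + scaleC \<i> (of_real t))"
  shows "Im c = 0"
proof (rule ccontr)
  assume nz: "Im c \<noteq> 0"
  \<comment> \<open>Makes the cross term 2 t Im c equal to twice the square of
    \<open>norm h\<close>, more than the bound allows.\<close>
  define t where "t = (norm h)\<^sup>2 / Im c"
  have "(Im c + t)\<^sup>2 \<le> (cmod (c + \<i> * of_real t))\<^sup>2"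
    using power_mono[OF abs_Im_le_cmod[of "c + \<i> * of_real t"], of 2] by simp
  also have "\<dots> \<le> (norm (h + scaleC \<i> (of_real t)))\<^sup>2"
    by (intro power_mono bound) auto
  also have "\<dots> = norm (h * h + of_real (t\<^sup>2))"
    using norm_sa_add_i[of h "of_real t"] h by (simp add: of_real_mult_commute[of t h] power2_eq_square)
  also have "\<dots> \<le> norm (h * h) + norm (of_real (t\<^sup>2) :: 'a)"
    by (rule norm_triangle_ineq)
  also have "\<dots> = (norm h)\<^sup>2 + t\<^sup>2"
    by (simp only: norm_square_sa[OF h] norm_of_real abs_power2)
  finally have "(Im c)\<^sup>2 + 2 * (Im c * t) \<le> (norm h)\<^sup>2" by (simp add: power2_sum)
  moreover have "Im c * t = (norm h)\<^sup>2" using nz by (simp add: t_def)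
  moreover have "(Im c)\<^sup>2 > 0" using nz by simp
  moreover have "(norm h)\<^sup>2 \<ge> 0" by simp
  ultimately show False by linarith
qed

text \<open>Instantiated by the MASA, and also by bicommutants of single self-adjoint elements when
  hermitian squares are treated.\<close>

locale abelian_inclusion =
  fixes B :: "'a::cstar_algebra set"
  assumes inclusion: "inclusion B"
begin

lemma csubspace: "csubspace B"
  using inclusion by (auto simp: inclusion_def abelian_cstar_subalgebra_def cstar_subalgebra_def)

lemma
  assumes "x \<in> B" "y \<in> B"
  shows add [simp]: "x + y \<in> B" and diff [simp]: "x - y \<in> B" and mult [simp]: "x * y \<in> B"
    and commute: "x * y = y * x"
  using inclusion assms csubspace
  by (auto simp: inclusion_def abelian_cstar_subalgebra_def cstar_subalgebra_def
      scaleC.subspace_add scaleC.subspace_diff)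

lemma
  shows one [simp]: "1 \<in> B" and zero [simp]: "0 \<in> B"
  using inclusion csubspace by (auto simp: inclusion_def scaleC.subspace_0)

lemma
  assumes "x \<in> B"
  shows minus [simp]: "- x \<in> B" and star [simp]: "star x \<in> B"
    and scaleC [simp]: "scaleC c x \<in> B"
  using inclusion assms csubspace
  by (auto simp: inclusion_def abelian_cstar_subalgebra_def cstar_subalgebra_def
      scaleC.subspace_neg scaleC.subspace_scale)

lemma scaleR [simp]: "x \<in> B \<Longrightarrow> r *\<^sub>R x \<in> B"
  by (metis scaleC scaleC_of_real)

lemma of_real [simp]: "of_real r \<in> B"
  by (simp add: of_real_def)

lemma left_commute: "x \<in> B \<Longrightarrow> y \<in> B \<Longrightarrow> x * (y * z) = y * (x * z)"
  by (metis commute mult.assoc)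

lemma closed_subalgebra: "closed_subalgebra B"
  using inclusion
  by (auto simp: closed_subalgebra_def subspace_def inclusion_def abelian_cstar_subalgebra_def
      cstar_subalgebra_def)

lemma sa_decomposition:
  assumes "x \<in> B"
  obtains a b where "a \<in> B" "b \<in> B" "star a = a" "star b = b" "x = a + scaleC \<i> b"
proof
  show "(1/2) *\<^sub>R (x + star x) \<in> B" "scaleC (- \<i> / 2) (x - star x) \<in> B" using assms by auto
qed (simp_all only: sa_parts)

section \<open>Elementary properties of characters\<close>

lemma
  assumes "\<sigma> \<in> characters B"
  shows character_add: "x \<in> B \<Longrightarrow> y \<in> B \<Longrightarrow> \<sigma> (x + y) = \<sigma> x + \<sigma> y"
    and character_scaleC: "x \<in> B \<Longrightarrow> \<sigma> (scaleC a x) = a * \<sigma> x"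
    and character_mult: "x \<in> B \<Longrightarrow> y \<in> B \<Longrightarrow> \<sigma> (x * y) = \<sigma> x * \<sigma> y"
  using assms by (auto simp: characters_def)

lemma character_1: "\<sigma> \<in> characters B \<Longrightarrow> \<sigma> 1 = 1"
proof -
  assume \<sigma>: "\<sigma> \<in> characters B"
  then obtain x where "x \<in> B" "\<sigma> x \<noteq> 0" by (auto simp: characters_def)
  then show ?thesis using character_mult[OF \<sigma>, of x 1] by simp
qed

lemma
  assumes "\<sigma> \<in> characters B"
  shows character_0: "\<sigma> 0 = 0"
    and character_minus: "x \<in> B \<Longrightarrow> \<sigma> (- x) = - \<sigma> x"
    and character_diff: "x \<in> B \<Longrightarrow> y \<in> B \<Longrightarrow> \<sigma> (x - y) = \<sigma> x - \<sigma> y"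
    and character_of_real: "\<sigma> (of_real r) = of_real r"
    and character_scaleR: "x \<in> B \<Longrightarrow> \<sigma> (r *\<^sub>R x) = of_real r * \<sigma> x"
proof -
  show m: "\<sigma> (- x) = - \<sigma> x" if "x \<in> B" for x
    using character_scaleC[OF assms that, of "- 1"] by (simp add: scaleC.scale_minus_left)
  show "\<sigma> 0 = 0" using character_scaleC[OF assms, of 0 0] by simp
  show "x \<in> B \<Longrightarrow> y \<in> B \<Longrightarrow> \<sigma> (x - y) = \<sigma> x - \<sigma> y"
    using character_add[OF assms, of x "- y"] m by simp
  show s: "\<sigma> (r *\<^sub>R x) = of_real r * \<sigma> x" if "x \<in> B" for x r
    using character_scaleC[OF assms that, of "of_real r"] by (simp add: scaleC_of_real)
  show "\<sigma> (of_real r) = of_real r"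
    using s[of 1 r] character_1[OF assms] by (simp add: of_real_def)
qed

text \<open>Continuity is automatic: otherwise \<open>x\<close>, rescaled to have value 1, is some
  \<open>z\<close> with \<open>norm z < 1\<close>, and \<open>\<sigma>\<close> kills the invertible
  element 1 - z.\<close>

lemma character_norm_le:
  assumes \<sigma>: "\<sigma> \<in> characters B" and x: "x \<in> B"
  shows "cmod (\<sigma> x) \<le> norm x"
proof (rule ccontr)
  assume "\<not> ?thesis"
  then have lt: "norm x < cmod (\<sigma> x)" by simp
  then have nz: "\<sigma> x \<noteq> 0" by auto
  define z where "z = scaleC (1 / \<sigma> x) x"
  have z: "z \<in> B" "norm z < 1" "\<sigma> z = 1"
    using x lt nz \<sigma> by (auto simp: z_def norm_scaleC norm_divide character_scaleC divide_simps)
  obtain s where s: "s \<in> B" "(1 - z) * s = 1"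
    using neumann_inverse[OF closed_subalgebra z(1,2)] by metis
  have "\<sigma> ((1 - z) * s) = (\<sigma> 1 - \<sigma> z) * \<sigma> s"
    using \<sigma> z(1) s(1) by (simp add: character_mult character_diff)
  then show False using s(2) z(3) character_1[OF \<sigma>] by simp
qed

lemma character_sa_real:
  assumes \<sigma>: "\<sigma> \<in> characters B" and h: "h \<in> B" "star h = h"
  shows "Im (\<sigma> h) = 0"
proof (rule sa_real_of_norm_bound[OF h(2)])
  fix t
  show "cmod (\<sigma> h + \<i> * of_real t) \<le> norm (h + scaleC \<i> (of_real t))"
    using character_norm_le[OF \<sigma>, of "h + scaleC \<i> (of_real t)"] h \<sigma>
    by (simp add: character_add character_scaleC character_of_real)
qed

lemma character_star:
  assumes \<sigma>: "\<sigma> \<in> characters B" and x: "x \<in> B"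
  shows "\<sigma> (star x) = cnj (\<sigma> x)"
proof -
  obtain a b where ab: "a \<in> B" "b \<in> B" "star a = a" "star b = b" "x = a + scaleC \<i> b"
    using sa_decomposition[OF x] by metis
  have "cnj (\<sigma> a) = \<sigma> a" "cnj (\<sigma> b) = \<sigma> b"
    using character_sa_real[OF \<sigma>] ab by (auto simp: complex_eq_iff)
  moreover have "star x = a + scaleC (- \<i>) b" using ab by (simp add: star_simps)
  ultimately show ?thesis
    using ab \<sigma> by (simp add: character_add character_diff character_scaleC)
qed

lemma cpositive_sqrt_in:
  assumes "a \<in> B" "cpositive a"
  obtains s where "cpositive s" "s * s = a" "s \<in> B"
proof (rule cpositive_obtain_sqrt[OF assms(2)])
  fix s assume s: "cpositive s" "s * s = a" "\<And>B. closed_subalgebra B \<Longrightarrow> a \<in> B \<Longrightarrow> s \<in> B"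
  then show thesis using that s(3)[OF closed_subalgebra assms(1)] by blast
qed

lemma character_cpositive:
  assumes \<sigma>: "\<sigma> \<in> characters B" and a: "a \<in> B" "cpositive a"
  shows "\<sigma> a \<in> \<real>\<^sub>\<ge>\<^sub>0"
proof -
  obtain s where s: "cpositive s" "s * s = a" "s \<in> B"
    by (rule cpositive_sqrt_in[OF a])
  have "Im (\<sigma> s) = 0" using character_sa_real[OF \<sigma> s(3)] s(1) by (simp add: cpositive_star)
  then have "\<sigma> s = of_real (Re (\<sigma> s))" by (simp add: complex_eq_iff)
  then have "\<sigma> s * \<sigma> s = of_real ((Re (\<sigma> s))\<^sup>2)"
    by (simp only: power2_eq_square of_real_mult)
  moreover have "\<sigma> a = \<sigma> s * \<sigma> s" using character_mult[OF \<sigma> s(3) s(3)] s(2) by simp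
  ultimately show ?thesis by (simp only: nonneg_Reals_of_real_iff zero_le_power2)
qed

section \<open>Proper preorderings of the self-adjoint part, as in real algebra\<close>

definition preordering :: "'a set \<Rightarrow> bool" where
  "preordering M \<longleftrightarrow> M \<subseteq> {a \<in> B. star a = a} \<and> (\<forall>x\<in>M. \<forall>y\<in>M. x + y \<in> M \<and> x * y \<in> M) \<and>
     (\<forall>a\<in>B. cpositive a \<longrightarrow> a \<in> M) \<and> - 1 \<notin> M"

text \<open>Terms linear in \<open>a\<close> are enough for closure under products, because
  \<open>a * a\<close> is positive and so already belongs to a preordering.\<close>

definition adjoin :: "'a set \<Rightarrow> 'a \<Rightarrow> 'a set" where
  "adjoin M a = {s + a * t |s t. s \<in> M \<and> t \<in> M}"

lemma preordering_adjoin: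
  assumes M: "preordering M" and a: "a \<in> B" "star a = a" and "- 1 \<notin> adjoin M a"
  shows "preordering (adjoin M a)"
proof -
  have 0: "0 \<in> M" using M by (auto simp: preordering_def cpositive_def)
  have aa: "a * a \<in> M" using M a cpositive_square[OF a(2)] by (auto simp: preordering_def)
  have MB: "x \<in> M \<Longrightarrow> x \<in> B \<and> star x = x" for x using M by (auto simp: preordering_def)
  have add: "x \<in> M \<Longrightarrow> y \<in> M \<Longrightarrow> x + y \<in> M" and mult: "x \<in> M \<Longrightarrow> y \<in> M \<Longrightarrow> x * y \<in> M" for x y
    using M by (auto simp: preordering_def)
  have "adjoin M a \<subseteq> {a \<in> B. star a = a}"
    using MB a by (auto simp: adjoin_def star_add star_mult commute)
  moreover have "x + y \<in> adjoin M a \<and> x * y \<in> adjoin M a"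
    if xy: "x \<in> adjoin M a" "y \<in> adjoin M a" for x y
  proof -
    obtain s t s' t' where st: "x = s + a * t" "y = s' + a * t'" "s \<in> M" "t \<in> M" "s' \<in> M" "t' \<in> M"
      using xy by (auto simp: adjoin_def)
    have "x + y = (s + s') + a * (t + t')" using st by (simp add: algebra_simps)
    moreover have "x * y = (s * s' + (a * a) * (t * t')) + a * (s * t' + t * s')"
      using st MB a by (simp add: algebra_simps left_commute)
    moreover have "s + s' \<in> M" "t + t' \<in> M" "s * s' + (a * a) * (t * t') \<in> M" "s * t' + t * s' \<in> M"
      using st add mult aa by auto
    ultimately show ?thesis unfolding adjoin_def by blast
  qed
  moreover have "M \<subseteq> adjoin M a" using 0 by (force simp: adjoin_def)
  ultimately show ?thesis using M assms(4) unfolding preordering_def by blast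
qed

lemma preordering_maximal:
  assumes "preordering M0"
  obtains M where "preordering M" "M0 \<subseteq> M" "\<And>X. preordering X \<Longrightarrow> M \<subseteq> X \<Longrightarrow> X = M"
proof -
  let ?A = "{M. preordering M \<and> M0 \<subseteq> M}"
  have "\<exists>M\<in>?A. \<forall>X\<in>?A. M \<subseteq> X \<longrightarrow> X = M"
  proof (rule subset_Zorn_nonempty)
    show "?A \<noteq> {}" using assms by auto
    fix C assume C: "C \<noteq> {}" "subset.chain ?A C"
    then have pre: "\<And>M. M \<in> C \<Longrightarrow> preordering M \<and> M0 \<subseteq> M"
      and tot: "\<And>M N. M \<in> C \<Longrightarrow> N \<in> C \<Longrightarrow> M \<subseteq> N \<or> N \<subseteq> M"
      unfolding subset_chain_def by (blast, metis)
    have preD: "M \<subseteq> {a \<in> B. star a = a}" "\<forall>x\<in>M. \<forall>y\<in>M. x + y \<in> M \<and> x * y \<in> M"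
      "\<forall>a\<in>B. cpositive a \<longrightarrow> a \<in> M" "- 1 \<notin> M" "M0 \<subseteq> M" if "M \<in> C" for M
      using pre[OF that] unfolding preordering_def by simp_all
    have cl: "x + y \<in> \<Union>C" "x * y \<in> \<Union>C" if xy: "x \<in> \<Union>C" "y \<in> \<Union>C" for x y
    proof -
      obtain M1 M2 where M12: "M1 \<in> C" "x \<in> M1" "M2 \<in> C" "y \<in> M2" using xy by blast
      obtain M where "M \<in> C" "x \<in> M" "y \<in> M"
      proof (cases "M1 \<subseteq> M2")
        case True
        then show ?thesis using that[of M2] M12 by blast
      next
        case False
        then show ?thesis using that[of M1] M12 tot[of M1 M2] by blast
      qed
      then have "x + y \<in> M" "x * y \<in> M" using preD(2) by auto
      then show "x + y \<in> \<Union>C" "x * y \<in> \<Union>C" using \<open>M \<in> C\<close> by blast+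
    qed
    obtain M where M: "M \<in> C" using C(1) by auto
    have "preordering (\<Union>C)" unfolding preordering_def
    proof (intro conjI ballI impI cl)
      show "\<Union>C \<subseteq> {a \<in> B. star a = a}" "- 1 \<notin> \<Union>C" using preD(1,4) by auto
      show "a \<in> \<Union>C" if "a \<in> B" "cpositive a" for a using preD(3)[OF M] M that by blast
    qed
    moreover have "M0 \<subseteq> \<Union>C" using preD(5)[OF M] M by blast
    ultimately show "\<Union>C \<in> ?A" by (intro CollectI conjI)
  qed
  then obtain M where M: "M \<in> ?A" "\<forall>X\<in>?A. M \<subseteq> X \<longrightarrow> X = M" by (rule bexE)
  show ?thesis
  proof (rule that[of M])
    show "preordering M" "M0 \<subseteq> M" using M(1) by simp_all
    fix X assume "preordering X" "M \<subseteq> X"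
    moreover from this have "X \<in> ?A" using \<open>M0 \<subseteq> M\<close> by auto
    ultimately show "X = M" using M(2) by simp
  qed
qed

end

section \<open>The character of a maximal preordering\<close>

locale maximal_preordering = abelian_inclusion +
  fixes M
  assumes preordering: "preordering M"
    and maximal: "\<And>X. preordering X \<Longrightarrow> M \<subseteq> X \<Longrightarrow> X = M"
begin

lemma
  assumes "x \<in> M" "y \<in> M"
  shows M_add: "x + y \<in> M" and M_mult: "x * y \<in> M"
  using preordering assms by (auto simp: preordering_def)

lemma
  assumes "x \<in> M"
  shows M_B: "x \<in> B" and M_sa: "star x = x"
  using preordering assms by (auto simp: preordering_def)

lemma M_positive: "a \<in> B \<Longrightarrow> cpositive a \<Longrightarrow> a \<in> M" and M_neg_1: "- 1 \<notin> M"
  using preordering by (auto simp: preordering_def)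

lemma M_of_real: "of_real r \<in> M \<longleftrightarrow> r \<ge> 0"
proof
  assume r: "of_real r \<in> M"
  show "r \<ge> 0"
  proof (rule ccontr)
    assume "\<not> r \<ge> 0"
    then have "of_real r * of_real (- 1 / r) \<in> M"
      by (intro M_mult[OF r] M_positive cpositive_of_real) (auto simp: field_simps)
    moreover have "of_real r * of_real (- 1 / r) = (- 1 :: 'a)"
      using \<open>\<not> r \<ge> 0\<close> by (simp flip: of_real_mult)
    ultimately show False using M_neg_1 by metis
  qed
qed (simp add: M_positive)

text \<open>If neither sign can be adjoined, -1 has a representation with \<open>a\<close> and one
  with - a. Multiplying the resulting formulas for \<open>a * t\<close> and \<open>a * t'\<close>
  leaves only the square of \<open>a\<close>, and -1 becomes a sum of members of
  \<open>M\<close>.\<close>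

lemma M_total:
  assumes a: "a \<in> B" "star a = a"
  shows "a \<in> M \<or> - a \<in> M"
proof (rule ccontr)
  assume *: "\<not> ?thesis"
  have neg1: "- 1 \<in> adjoin M b" if b: "b \<in> B" "star b = b" "b \<notin> M" for b
  proof (rule ccontr)
    assume "- 1 \<notin> adjoin M b"
    then have "preordering (adjoin M b)" using preordering_adjoin preordering b by blast
    moreover have "M \<subseteq> adjoin M b" "b \<in> adjoin M b"
      using M_of_real[of 0] M_of_real[of 1] by (force simp: adjoin_def)+
    ultimately show False using maximal b by blast
  qed
  obtain s t s' t' where st: "- 1 = s + a * t" "- 1 = s' + (- a) * t'" "s \<in> M" "t \<in> M" "s' \<in> M" "t' \<in> M"
    using neg1[of a] neg1[of "- a"] a * by (auto simp: adjoin_def)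
  have "a * t = (s + a * t) - s" "a * t' = s' - (s' + (- a) * t')" by simp_all
  then have e: "a * t = - 1 - s" "a * t' = 1 + s'" unfolding st(1,2)[symmetric] by simp_all
  have "(a * a) * (t * t') = (a * t) * (a * t')"
    using a st M_B by (simp add: mult.assoc left_commute)
  also have "\<dots> = - 1 - (s + s' + s * s')" unfolding e by (simp add: algebra_simps)
  finally have "- 1 = s + s' + s * s' + (a * a) * (t * t')" by simp
  moreover have "\<dots> \<in> M"
    using st a by (intro M_add M_mult M_positive[of "a * a"] cpositive_square) auto
  ultimately show False using M_neg_1 by metis
qed

text \<open>The real number cut out by \<open>a\<close> in the order given by \<open>M\<close>. The
  margin \<open>e\<close> avoids deciding on which side of the cut the endpoint itself
  falls.\<close>

definition val :: "'a \<Rightarrow> real \<Rightarrow> bool" where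
  "val a l \<longleftrightarrow> (\<forall>e>0. of_real (l + e) - a \<in> M \<and> a - of_real (l - e) \<in> M)"

lemma valD: "val a l \<Longrightarrow> e > 0 \<Longrightarrow> of_real (l + e) - a \<in> M"
  "val a l \<Longrightarrow> e > 0 \<Longrightarrow> a - of_real (l - e) \<in> M"
  by (auto simp: val_def)

text \<open>\<open>M\<close> is archimedean: it contains both differences of \<open>norm a\<close>
  and plus or minus \<open>a\<close>. So the real lower bounds of \<open>a\<close> form a nonempty
  bounded set, and totality of \<open>M\<close> handles every real above the supremum.\<close>

lemma val_exists:
  assumes a: "a \<in> B" "star a = a"
  shows "\<exists>l. val a l"
proof -
  let ?S = "{r. a - of_real r \<in> M}"
  have le: "r \<le> norm a" if "r \<in> ?S" for r
  proof -
    have "of_real (norm a) - a \<in> M" using a by (intro M_positive cpositive_of_real_minus) auto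
    then have "(of_real (norm a) - a) + (a - of_real r) \<in> M" using that by (intro M_add) auto
    then show ?thesis using M_of_real[of "norm a - r"] by simp
  qed
  have bdd: "bdd_above ?S" using le by (rule bdd_aboveI)
  have "of_real (norm a) + a \<in> M" using a by (intro M_positive cpositive_of_real_plus) auto
  then have ne: "- norm a \<in> ?S" by (simp add: add.commute)
  have "val a (Sup ?S)" unfolding val_def
  proof (intro allI impI conjI)
    fix e :: real assume e: "e > 0"
    show "of_real (Sup ?S + e) - a \<in> M"
    proof (rule ccontr)
      assume "of_real (Sup ?S + e) - a \<notin> M"
      then have "- (of_real (Sup ?S + e) - a) \<in> M"
        using M_total[of "of_real (Sup ?S + e) - a"] a by (auto simp: star_diff simp del: of_real_add)
      then have "Sup ?S + e \<in> ?S" by simp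
      then show False using cSup_upper[OF _ bdd] e by fastforce
    qed
    obtain r where r: "r \<in> ?S" "r > Sup ?S - e"
      using less_cSupE[of "Sup ?S - e" ?S] ne e by (metis diff_less_eq empty_iff less_add_same_cancel1)
    then have "(a - of_real r) + of_real (r - (Sup ?S - e)) \<in> M"
      by (intro M_add) (auto simp: M_of_real simp del: of_real_diff)
    then show "a - of_real (Sup ?S - e) \<in> M" by (simp add: algebra_simps)
  qed
  then show ?thesis by blast
qed

lemma val_unique:
  assumes "val a l" "val a m" shows "l = m"
proof -
  have "l \<ge> m" if "val a l" "val a m" for l m
  proof (rule ccontr)
    assume "\<not> l \<ge> m"
    then have e: "(m - l) / 3 > 0" by simp
    have "(of_real (l + (m - l) / 3) - a) + (a - of_real (m - (m - l) / 3)) \<in> M"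
      using that e by (intro M_add valD)
    moreover have "(of_real (l + (m - l) / 3) - a) + (a - of_real (m - (m - l) / 3))
        = of_real ((l + (m - l) / 3) - (m - (m - l) / 3))"
      by (simp only: of_real_diff) simp
    ultimately have "(l + (m - l) / 3) - (m - (m - l) / 3) \<ge> 0" by (metis M_of_real)
    then show False using e by (simp add: field_simps)
  qed
  from this[OF assms] this[OF assms(2,1)] show ?thesis by simp
qed

lemma val_add:
  assumes "val a l" "val b m" shows "val (a + b) (l + m)"
  unfolding val_def
proof (intro allI impI)
  fix e :: real assume "e > 0"
  then have e: "e / 2 > 0" by simp
  have "(of_real (l + e / 2) - a) + (of_real (m + e / 2) - b) \<in> M"
    and "(a - of_real (l - e / 2)) + (b - of_real (m - e / 2)) \<in> M"
    using e assms by (auto intro!: M_add valD simp del: of_real_add of_real_diff)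
  moreover have "(of_real (l + e / 2) - a) + (of_real (m + e / 2) - b)
      = of_real ((l + e / 2) + (m + e / 2)) - (a + b)"
    by (simp only: of_real_add) simp
  moreover have "(a - of_real (l - e / 2)) + (b - of_real (m - e / 2))
      = (a + b) - of_real ((l - e / 2) + (m - e / 2))"
    by (simp only: of_real_add) simp
  moreover have "(l + e / 2) + (m + e / 2) = l + m + e" "(l - e / 2) + (m - e / 2) = l + m - e"
    by simp_all
  ultimately show "of_real (l + m + e) - (a + b) \<in> M \<and> a + b - of_real (l + m - e) \<in> M"
    by metis
qed

lemma val_of_real: "val (of_real r) r"
  by (auto simp: val_def M_of_real simp flip: of_real_diff)

lemma val_minus: "val a l \<Longrightarrow> val (- a) (- l)"
  unfolding val_def by (auto simp: algebra_simps)

lemma val_scaleR: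
  assumes "val a l" shows "val (r *\<^sub>R a) (r * l)"
proof -
  have pos: "val (r *\<^sub>R a) (r * l)" if r: "r > 0" for r
    unfolding val_def
  proof (intro allI impI)
    fix e :: real assume "e > 0"
    then have e: "e / r > 0" using r by simp
    have "of_real r * (of_real (l + e / r) - a) \<in> M" "of_real r * (a - of_real (l - e / r)) \<in> M"
      using e assms r by (auto intro!: M_mult valD simp: M_of_real simp del: of_real_add of_real_diff)
    moreover have "of_real r * (of_real (l + e / r) - a) = of_real (r * (l + e / r)) - r *\<^sub>R a"
      "of_real r * (a - of_real (l - e / r)) = r *\<^sub>R a - of_real (r * (l - e / r))"
      by (simp_all only: of_real_mult right_diff_distrib[of "of_real r :: 'a"] scaleR_conv_of_real)
    moreover have "r * (l + e / r) = r * l + e" "r * (l - e / r) = r * l - e"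
      using r by (auto simp: field_simps)
    ultimately show "of_real (r * l + e) - r *\<^sub>R a \<in> M \<and> r *\<^sub>R a - of_real (r * l - e) \<in> M"
      by metis
  qed
  consider "r > 0" | "r = 0" | "r < 0" by linarith
  then show ?thesis
  proof cases
    case 2 then show ?thesis using val_of_real[of 0] by simp
  next
    case 3 then show ?thesis using val_minus[OF pos[of "- r"]] by simp
  qed (rule pos)
qed

lemma val_square_0:
  assumes a: "a \<in> B" "star a = a" "val a 0" shows "val (a * a) 0"
  unfolding val_def
proof (intro allI impI conjI)
  fix e :: real assume e: "e > 0"
  \<comment> \<open>Factors e - a^2 as (d - a) (a + d), a product of two members of
    \<open>M\<close>.\<close>
  define d where "d = sqrt e"
  have d: "d > 0" "d * d = e" using e by (auto simp: d_def)
  have "(of_real d - a) * (a + of_real d) \<in> M"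
    using valD[OF a(3) d(1)] by (intro M_mult) (auto)
  moreover have "(of_real d - a) * (a + of_real d) = of_real (0 + e) - a * a"
    using d(2) by (simp add: algebra_simps of_real_mult_commute[of d a] flip: of_real_mult)
  ultimately show "of_real (0 + e) - a * a \<in> M" by metis
  have "a * a + of_real e \<in> M"
    using e a by (intro M_add M_positive[of "a * a"] cpositive_square) (auto simp: M_of_real)
  then show "a * a - of_real (0 - e) \<in> M" by simp
qed

text \<open>Shifting by the value reduces to value zero, since a^2 = (a - l)^2 + 2 l a - l^2 and
  \<open>val\<close> is already known to be linear.\<close>

lemma val_square:
  assumes a: "a \<in> B" "star a = a" "val a l" shows "val (a * a) (l * l)"
proof -
  have "val (a + of_real (- l)) (l + - l)" by (rule val_add[OF a(3) val_of_real])
  then have "val ((a + of_real (- l)) * (a + of_real (- l))) 0"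
    using a by (intro val_square_0) (auto simp: star_simps)
  then have "val ((a + of_real (- l)) * (a + of_real (- l)) + (2 * l) *\<^sub>R a + of_real (- (l * l)))
      (0 + (2 * l) * l + - (l * l))"
    by (rule val_add[OF val_add[OF _ val_scaleR[OF a(3)]] val_of_real])
  moreover have two: "(2 * l) *\<^sub>R a = of_real l * a + of_real l * a"
    by (simp only: mult_2 scaleR_conv_of_real of_real_add distrib_right)
  moreover have "(a + of_real (- l)) * (a + of_real (- l)) + (2 * l) *\<^sub>R a + of_real (- (l * l)) = a * a"
    unfolding two by (simp add: algebra_simps of_real_mult_commute[of l a])
  ultimately show ?thesis by simp
qed

text \<open>Polarisation from squares; commutativity of \<open>B\<close> is what lets it recover
  \<open>a * b\<close>.\<close>

lemma val_mult:
  assumes a: "a \<in> B" "star a = a" "val a l" and b: "b \<in> B" "star b = b" "val b m"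
  shows "val (a * b) (l * m)"
proof -
  have "val ((1/2) *\<^sub>R ((a + b) * (a + b) + - (a * a) + - (b * b)))
      ((1/2) * ((l + m) * (l + m) + - (l * l) + - (m * m)))"
    using a b by (intro val_scaleR val_add val_minus val_square) (auto simp: star_add)
  moreover have "(1/2) *\<^sub>R ((a + b) * (a + b) + - (a * a) + - (b * b)) = a * b"
    using commute[OF a(1) b(1)] by (simp add: algebra_simps flip: scaleR_add_left)
  moreover have "(1/2) * ((l + m) * (l + m) + - (l * l) + - (m * m)) = l * m"
    by (simp add: algebra_simps)
  ultimately show ?thesis by simp
qed

lemma val_nonneg:
  assumes "a \<in> M" "val a l" shows "l \<ge> 0"
proof (rule ccontr)
  assume "\<not> l \<ge> 0"
  then have "(of_real (l + - l / 2) - a) + a \<in> M" using assms by (intro M_add valD) auto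
  then show False using \<open>\<not> l \<ge> 0\<close> M_of_real[of "l + - l / 2"] by simp
qed

lemma character_exists:
  obtains \<tau> where "\<tau> \<in> characters B" "\<And>a. a \<in> M \<Longrightarrow> Re (\<tau> a) \<ge> 0"
proof -
  define t where "t a = (SOME l. val a l)" for a
  have t: "val a (t a)" if "a \<in> B" "star a = a" for a
    unfolding t_def using val_exists[OF that] by (rule someI_ex)
  have tI: "t a = l" if "a \<in> B" "star a = a" "val a l" for a l
    using t that val_unique by blast
  \<comment> \<open>Uniqueness of the self-adjoint decomposition makes the description
    single-valued; the value \<open>undefined\<close> off \<open>B\<close> makes the function
    extensional, as characters must be.\<close>
  define \<tau> where "\<tau> x = (if x \<in> B then
     (THE c. \<exists>a b. a \<in> B \<and> b \<in> B \<and> star a = a \<and> star b = b \<and> x = a + scaleC \<i> b \<and>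
        c = Complex (t a) (t b)) else undefined)" for x
  have \<tau>: "\<tau> (a + scaleC \<i> b) = Complex (t a) (t b)"
    if "a \<in> B" "b \<in> B" "star a = a" "star b = b" for a b
  proof -
    have "(THE c. \<exists>a' b'. a' \<in> B \<and> b' \<in> B \<and> star a' = a' \<and> star b' = b' \<and>
        a + scaleC \<i> b = a' + scaleC \<i> b' \<and> c = Complex (t a') (t b')) = Complex (t a) (t b)"
      using that sa_decomposition_unique by (intro the_equality) blast+
    then show ?thesis using that by (simp add: \<tau>_def)
  qed
  have t_add: "t (a + b) = t a + t b" and t_mult: "t (a * b) = t a * t b"
    and t_scaleR: "t (r *\<^sub>R a) = r * t a" and t_diff: "t (a - b) = t a - t b"
    if "a \<in> B" "b \<in> B" "star a = a" "star b = b" for a b r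
    using that t val_add[of a "t a" b "t b"] val_mult val_scaleR
      val_add[of a "t a" "- b" "- t b"] val_minus[of b "t b"]
    by (auto intro!: tI simp: star_simps commute)
  have Re_\<tau>: "\<tau> a = of_real (t a)" if "a \<in> B" "star a = a" for a
  proof -
    have "t 0 = 0" using val_of_real[of 0] by (intro tI) auto
    then show ?thesis using \<tau>[of a 0] that by (simp add: complex_eq_iff)
  qed
  have "\<tau> \<in> characters B" unfolding characters_def
  proof (intro CollectI conjI ballI allI)
    show "\<tau> \<in> extensional B" by (simp add: \<tau>_def extensional_def)
    show "\<exists>x\<in>B. \<tau> x \<noteq> 0"
    proof
      have "t 1 = 1" using val_of_real[of 1] by (intro tI) auto
      then show "\<tau> 1 \<noteq> 0" using Re_\<tau>[of 1] by simp
    qed simp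
  next
    fix x y assume xy: "x \<in> B" "y \<in> B"
    obtain a b where x: "a \<in> B" "b \<in> B" "star a = a" "star b = b" "x = a + scaleC \<i> b"
      using sa_decomposition[OF xy(1)] by metis
    obtain c d where y: "c \<in> B" "d \<in> B" "star c = c" "star d = d" "y = c + scaleC \<i> d"
      using sa_decomposition[OF xy(2)] by metis
    have e: "x + y = (a + c) + scaleC \<i> (b + d)" using x y by (simp add: scaleC_add_right)
    have "\<tau> (x + y) = Complex (t (a + c)) (t (b + d))"
      unfolding e using x y by (intro \<tau>) (auto simp: star_add)
    then show "\<tau> (x + y) = \<tau> x + \<tau> y"
      using x y \<tau>[of a b] \<tau>[of c d] by (simp add: t_add complex_eq_iff)
    have e: "x * y = (a * c - b * d) + scaleC \<i> (a * d + b * c)"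
      using x y by (simp add: algebra_simps mult_scaleC_left mult_scaleC_right scaleC_scaleC
          scaleC_add_right scaleC.scale_minus_left)
    have "\<tau> (x * y) = Complex (t (a * c - b * d)) (t (a * d + b * c))"
      unfolding e using x y by (intro \<tau>) (auto simp: star_simps commute)
    then show "\<tau> (x * y) = \<tau> x * \<tau> y"
      using x y \<tau>[of a b] \<tau>[of c d]
      by (simp add: t_add t_mult t_diff star_mult commute complex_eq_iff)
  next
    fix x k assume xx: "x \<in> B"
    obtain a b where x: "a \<in> B" "b \<in> B" "star a = a" "star b = b" "x = a + scaleC \<i> b"
      using sa_decomposition[OF xx] by metis
    define p q where "p = Re k" and "q = Im k"
    have k: "k = of_real p + \<i> * of_real q" unfolding p_def q_def by (rule complex_eq)
    have i: "\<i> * of_real q * \<i> = - of_real q" "of_real p * \<i> = \<i> * of_real p"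
      by (simp_all add: complex_eq_iff)
    have e: "scaleC k x = (p *\<^sub>R a - q *\<^sub>R b) + scaleC \<i> (p *\<^sub>R b + q *\<^sub>R a)"
      unfolding k x(5) scaleC_of_real[symmetric] scaleC_add_left scaleC_add_right scaleC_scaleC
        distrib_right[of _ _ \<i>] i scaleC_add_left
        scaleC.scale_minus_left
      by (simp only: add_ac diff_conv_add_uminus)
    have "\<tau> (scaleC k x) = Complex (t (p *\<^sub>R a - q *\<^sub>R b)) (t (p *\<^sub>R b + q *\<^sub>R a))"
      unfolding e using x by (intro \<tau>) (auto simp: star_simps)
    then show "\<tau> (scaleC k x) = k * \<tau> x"
      using x \<tau>[of a b] by (simp add: t_add t_diff t_scaleR star_scaleR complex_eq_iff k)
  qed
  moreover have "Re (\<tau> a) \<ge> 0" if "a \<in> M" for a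
    using Re_\<tau>[of a] val_nonneg[OF that t] M_B M_sa that by simp
  ultimately show ?thesis using that by blast
qed

end

section \<open>Norm and positivity read off from characters\<close>

context abelian_inclusion
begin

lemma norm_le_norm_add_cpositive:
  fixes b c :: 'a
  assumes "b \<in> B" "cpositive b" "c \<in> B" "cpositive c"
  shows "norm b \<le> norm (b + c)"
proof -
  obtain s where s: "cpositive s" "s * s = b" "s \<in> B"
    by (rule cpositive_sqrt_in[OF assms(1,2)])
  obtain t where t: "cpositive t" "t * t = c" "t \<in> B"
    by (rule cpositive_sqrt_in[OF assms(3,4)])
  show ?thesis using norm_le_norm_sum_squares[of s t] s t by (simp add: cpositive_star commute)
qed

text \<open>A character nonnegative on a preordering containing b - 1, where b is the square of
  \<open>a\<close>, takes a value at least 1 at b. Such a preordering exists because -1 = s + (b -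
  1) t with positive s and t would force b below a constant smaller than 1, against
  \<open>norm b = 1\<close>. Squaring handles both signs of \<open>a\<close> at once.\<close>

lemma gelfand_norm_attained_unit:
  assumes a: "a \<in> B" "star a = a" "norm a = 1"
  obtains \<tau> where "\<tau> \<in> characters B" "cmod (\<tau> a) = 1"
proof -
  define b where "b = a * a"
  define T where "T = {x \<in> B. cpositive x}"
  have b: "b \<in> B" "cpositive b" "norm b = 1" "star b = b"
    using a by (auto simp: b_def cpositive_square norm_square_sa star_mult)
  have c: "1 - b \<in> B" "cpositive (1 - b)"
    using cpositive_of_real_minus[of b 1] b by auto
  have "preordering T"
    by (auto simp: preordering_def T_def cpositive_add cpositive_mult commute cpositive_star)
       (auto simp: cpositive_def)
  have "- 1 \<notin> adjoin T (b - 1)"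
  proof
    assume "- 1 \<in> adjoin T (b - 1)"
    then obtain s t where st: "- 1 = s + (b - 1) * t" "s \<in> T" "t \<in> T" by (auto simp: adjoin_def)
    \<comment> \<open>\<open>K\<close> is a positive upper bound of \<open>t\<close>. Replacing
      \<open>t\<close> by \<open>K\<close> gives (1 - b) (K - t) + s = (K - 1) - K b, so positivity
      of the left side bounds b by (K - 1) / K.\<close>
    define K where "K = norm t + 1"
    have K: "K > 0" unfolding K_def by (smt (verit) norm_ge_zero)
    have "cpositive (of_real K - t)"
      using st by (intro cpositive_of_real_minus) (auto simp: K_def T_def cpositive_star)
    then have "cpositive ((1 - b) * (of_real K - t))"
      using c st by (intro cpositive_mult commute) (auto simp: T_def)
    then have "cpositive ((1 - b) * (of_real K - t) + s)"
      using st by (intro cpositive_add) (auto simp: T_def)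
    moreover have "(1 - b) * (of_real K - t) + s = of_real (K - 1) - K *\<^sub>R b"
      using st(1) by (simp add: algebra_simps scaleR_conv_of_real of_real_mult_commute[of K b])
    ultimately have "cpositive ((1 / K) *\<^sub>R (of_real (K - 1) - K *\<^sub>R b))"
      using K by (intro cpositive_scaleR) auto
    moreover have "(1 / K) *\<^sub>R (of_real (K - 1) - K *\<^sub>R b) = of_real ((K - 1) / K) - b"
      using K by (simp add: scaleR_diff_right of_real_def)
    ultimately have "norm b \<le> norm (b + (of_real ((K - 1) / K) - b))"
      using b by (intro norm_le_norm_add_cpositive) auto
    then have "1 \<le> \<bar>(K - 1) / K\<bar>" using b(3) by (simp del: of_real_divide of_real_diff)
    moreover have "K \<ge> 1" by (simp add: K_def)
    ultimately show False using K by simp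
  qed
  then have "preordering (adjoin T (b - 1))"
    using \<open>preordering T\<close> b by (intro preordering_adjoin) (auto simp: star_simps)
  then obtain M where M: "preordering M" "adjoin T (b - 1) \<subseteq> M"
    "\<And>X. preordering X \<Longrightarrow> M \<subseteq> X \<Longrightarrow> X = M"
    using preordering_maximal by metis
  interpret maximal_preordering B M by unfold_locales (use M in auto)
  obtain \<tau> where \<tau>: "\<tau> \<in> characters B" "\<And>a. a \<in> M \<Longrightarrow> Re (\<tau> a) \<ge> 0"
    using character_exists by metis
  have "0 \<in> T" "1 \<in> T" using cpositive_of_real[of 0] cpositive_of_real[of 1] unfolding T_def by auto
  then have "b - 1 \<in> M" using M(2) by (force simp: adjoin_def)
  then have "Re (\<tau> b) \<ge> 1" using \<tau>(2)[of "b - 1"] \<tau>(1) b by (simp add: character_diff character_1)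
  moreover have "\<tau> b = \<tau> a * \<tau> a" using a \<tau>(1) by (simp add: b_def character_mult)
  ultimately have "1 \<le> cmod (\<tau> a) * cmod (\<tau> a)"
    by (metis complex_Re_le_cmod norm_mult order_trans)
  moreover have "cmod (\<tau> a) \<le> 1" using character_norm_le[OF \<tau>(1) a(1)] a(3) by simp
  moreover have "cmod (\<tau> a) * cmod (\<tau> a) \<le> cmod (\<tau> a)" if "cmod (\<tau> a) \<le> 1"
    using that by (simp add: mult_left_le)
  ultimately have "cmod (\<tau> a) = 1" by linarith
  with \<tau>(1) that show ?thesis by blast
qed

lemma gelfand_norm_attained:
  assumes a: "a \<in> B" "star a = a"
  obtains \<tau> where "\<tau> \<in> characters B" "cmod (\<tau> a) = norm a"
proof (cases "a = 0")
  case True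
  obtain \<tau> where "\<tau> \<in> characters B" "cmod (\<tau> 1) = 1"
    using gelfand_norm_attained_unit[of 1] by auto
  with True that show ?thesis by (simp add: character_0)
next
  case False
  obtain \<tau> where \<tau>: "\<tau> \<in> characters B" "cmod (\<tau> ((1 / norm a) *\<^sub>R a)) = 1"
    using gelfand_norm_attained_unit[of "(1 / norm a) *\<^sub>R a"] a False by (auto simp: star_scaleR)
  with that[of \<tau>] a False show ?thesis by (simp add: character_scaleR norm_mult norm_divide)
qed

text \<open>The norm in the definition of \<open>cpositive\<close> is attained at some character
  \<open>\<tau>\<close>, where it equals the difference of \<open>norm a\<close> and a number
  between 0 and \<open>norm a\<close>.\<close>

lemma cpositive_if_characters:
  assumes a: "a \<in> B" "star a = a" and pos: "\<And>\<tau>. \<tau> \<in> characters B \<Longrightarrow> Re (\<tau> a) \<ge> 0"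
  shows "cpositive a"
proof -
  obtain \<tau> where \<tau>: "\<tau> \<in> characters B"
    "cmod (\<tau> (of_real (norm a) - a)) = norm (of_real (norm a) - a)"
    using gelfand_norm_attained[of "of_real (norm a) - a"] a by (auto simp: star_diff)
  have "\<tau> a = of_real (Re (\<tau> a))" using character_sa_real \<tau> a by (simp add: complex_eq_iff)
  then have "\<tau> (of_real (norm a) - a) = of_real (norm a - Re (\<tau> a))"
    using \<tau> a by (simp add: character_diff character_of_real)
  then have "norm (of_real (norm a) - a) = \<bar>norm a - Re (\<tau> a)\<bar>"
    using \<tau>(2) by (metis norm_of_real)
  moreover have "Re (\<tau> a) \<le> norm a"
    using character_norm_le[OF \<tau>(1) a(1)] complex_Re_le_cmod order_trans by blast
  ultimately show ?thesis using pos[OF \<tau>(1)] a by (simp add: cpositive_def)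
qed

lemma eq_0_if_characters:
  assumes "a \<in> B" "star a = a" "\<And>\<tau>. \<tau> \<in> characters B \<Longrightarrow> \<tau> a = 0"
  shows "a = 0"
  using gelfand_norm_attained[OF assms(1,2)] assms(3) by (metis norm_eq_zero norm_zero)

end

subsection \<open>Maximal abelian subalgebras and positivity of hermitian squares\<close>

definition commutant :: "'a::cstar_algebra set \<Rightarrow> 'a set" where
  "commutant S = {y. \<forall>x\<in>S. x * y = y * x}"

lemma commutantD: "y \<in> commutant S \<Longrightarrow> x \<in> S \<Longrightarrow> x * y = y * x"
  by (simp add: commutant_def)

text \<open>The bicommutant plays the role of the generated C*-algebra: closedness and the unit come
  for free, inverses stay inside by \<open>bicommutant_inverse\<close>, and it is abelian because a
  commuting set lies in its own commutant.\<close>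

lemma inclusion_bicommutant:
  fixes S :: "'a::cstar_algebra set"
  assumes st: "\<And>x. x \<in> S \<Longrightarrow> star x \<in> S" and comm: "\<And>x y. x \<in> S \<Longrightarrow> y \<in> S \<Longrightarrow> x * y = y * x"
  shows "inclusion (commutant (commutant S))"
proof -
  let ?B = "commutant (commutant S)"
  have star_commutant: "star y \<in> commutant T" if "y \<in> commutant T" "\<And>x. x \<in> T \<Longrightarrow> star x \<in> T"
    for y :: 'a and T
    unfolding commutant_def
  proof (intro CollectI ballI)
    fix x assume "x \<in> T"
    then have "star x * y = y * star x" using that commutantD by blast
    then have "star (star x * y) = star (y * star x)" by (rule arg_cong)
    then show "x * star y = star y * x" by (simp add: star_mult star_star)
  qed
  have cl: "closed_subalgebra ?B" unfolding commutant_def[of "commutant S"]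
    by (rule closed_subalgebra_commutant)
  have "csubspace ?B"
    unfolding scaleC.subspace_def
  proof (intro conjI ballI allI)
    show "0 \<in> ?B" by (simp add: commutant_def)
    show "x + y \<in> ?B" if "x \<in> ?B" "y \<in> ?B" for x y
      using that by (simp add: commutant_def algebra_simps)
    show "scaleC c x \<in> ?B" if "x \<in> ?B" for c x
      using that by (simp add: commutant_def mult_scaleC_left mult_scaleC_right)
  qed
  moreover have "x * y = y * x" if x: "x \<in> ?B" and y: "y \<in> ?B" for x y
  proof -
    have "z \<in> commutant S" if "z \<in> S" for z using comm that by (simp add: commutant_def)
    then have "y \<in> commutant S" using commutantD[OF y] by (simp add: commutant_def)
    then show ?thesis using commutantD[OF x] by simp
  qed
  moreover have "star x \<in> ?B" if "x \<in> ?B" for x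
    using that by (rule star_commutant) (rule star_commutant[OF _ st])
  ultimately show ?thesis
    using cl unfolding inclusion_def abelian_cstar_subalgebra_def cstar_subalgebra_def closed_subalgebra_def
    by simp
qed

lemma subset_bicommutant: "x \<in> S \<Longrightarrow> x \<in> commutant (commutant S)"
  by (simp add: commutant_def)

lemma bicommutant_inverse:
  assumes a: "a \<in> commutant (commutant S)" and b: "a * b = 1" "b * a = 1"
  shows "b \<in> commutant (commutant S)"
  unfolding commutant_def[of "commutant S"]
proof (intro CollectI ballI)
  fix y assume y: "y \<in> commutant S"
  have "y * b = (b * a) * y * b" by (simp add: b)
  also have "\<dots> = b * (a * y) * b" by (simp add: mult.assoc)
  also have "a * y = y * a" using commutantD[OF a y] by simp
  also have "b * (y * a) * b = b * y * (a * b)" by (simp add: mult.assoc)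
  finally show "y * b = b * y" by (simp add: b)
qed

text \<open>\<open>x\<close> may fail to be normal, so it cannot be adjoined to \<open>D\<close>
  directly. Its self-adjoint parts commute with \<open>D\<close> as well; with either of them
  \<open>D\<close> forms a commuting self-adjoint set, whose abelian bicommutant equals
  \<open>D\<close> by maximality.\<close>

lemma masa_commutant:
  assumes D: "masa_inclusion D" and x: "\<And>d. d \<in> D \<Longrightarrow> d * x = x * d"
  shows "x \<in> D"
proof -
  interpret abelian_inclusion D using D by unfold_locales (simp add: masa_inclusion_def)
  have sa: "h \<in> D" if h: "star h = h" "\<And>d. d \<in> D \<Longrightarrow> d * h = h * d" for h
  proof -
    let ?S = "insert h D"
    have "inclusion (commutant (commutant ?S))"
      using h by (intro inclusion_bicommutant) (auto simp: commute)
    moreover have "?S \<subseteq> commutant (commutant ?S)" using subset_bicommutant by blast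
    ultimately have "commutant (commutant ?S) = D"
      using D unfolding masa_inclusion_def inclusion_def by (meson insert_subset)
    then show ?thesis using subset_bicommutant[of h ?S] by simp
  qed
  have xs: "d * star x = star x * d" if "d \<in> D" for d
  proof -
    have "star (star d * x) = star (x * star d)" using x[of "star d"] that by simp
    then show ?thesis by (simp add: star_mult star_star)
  qed
  have parts: "(1/2) *\<^sub>R (x + star x) \<in> D" "scaleC (- \<i> / 2) (x - star x) \<in> D"
    by (rule sa[OF sa_parts(1)], simp add: algebra_simps x xs)
      (rule sa[OF sa_parts(2)], simp add: algebra_simps x xs mult_scaleC_left mult_scaleC_right)
  have "(1/2) *\<^sub>R (x + star x) + scaleC \<i> (scaleC (- \<i> / 2) (x - star x)) \<in> D"
    by (rule add[OF parts(1) scaleC[OF parts(2)]])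
  then show ?thesis by (simp only: sa_parts(3))
qed

context abelian_inclusion
begin

text \<open>The absolute value is the positive root of the square; positivity fixes the sign at each
  character. With it positive and negative parts are available without a continuous functional
  calculus.\<close>

lemma abs_exists:
  assumes k: "k \<in> B" "star k = k"
  obtains m where "m \<in> B" "cpositive m" "m * m = k * k"
    "\<And>\<tau>. \<tau> \<in> characters B \<Longrightarrow> \<tau> m = of_real \<bar>Re (\<tau> k)\<bar>"
proof -
  obtain m where m: "cpositive m" "m * m = k * k" "m \<in> B"
    by (rule cpositive_sqrt_in[of "k * k"]) (use k in \<open>auto simp: cpositive_square\<close>)
  have "\<tau> m = of_real \<bar>Re (\<tau> k)\<bar>" if \<tau>: "\<tau> \<in> characters B" for \<tau>
  proof -
    obtain r where r: "\<tau> m = of_real r" "r \<ge> 0"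
      using character_cpositive[OF \<tau> m(3,1)] by (auto elim: nonneg_Reals_cases)
    have Im: "Im (\<tau> k) = 0" using character_sa_real[OF \<tau> k] .
    have "\<tau> m * \<tau> m = \<tau> k * \<tau> k" using character_mult[OF \<tau>] m k by metis
    then have "Re (\<tau> m * \<tau> m) = Re (\<tau> k * \<tau> k)" by (rule arg_cong)
    then have "r\<^sup>2 = (Re (\<tau> k))\<^sup>2" by (simp add: r Im power2_eq_square)
    then have "r = \<bar>Re (\<tau> k)\<bar>" using r(2) by (metis abs_of_nonneg power2_eq_iff abs_minus)
    then show ?thesis by (simp add: r)
  qed
  with m that show ?thesis by blast
qed

end

section \<open>Positivity of hermitian squares\<close>

lemma bicommutant_sa:
  assumes "star h = h"
  shows "abelian_inclusion (commutant (commutant {h}))"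
  using assms by unfold_locales (rule inclusion_bicommutant; simp)

lemma invertible_of_real_plus_positive:
  fixes c :: "'a::cstar_algebra"
  assumes c: "cpositive c" and r: "r > 0"
  obtains u where "(of_real r + c) * u = 1" "u * (of_real r + c) = 1"
proof -
  \<comment> \<open>With this scaling r + c = q (1 - z) for the \<open>z\<close> below, whose norm
    is at most \<open>norm c / q\<close> by positivity of \<open>c\<close>.\<close>
  define q where "q = norm c + r"
  have q: "q > 0" "q > norm c" using r norm_ge_zero[of c] by (simp_all add: q_def add_nonneg_pos)
  define z where "z = (1 / q) *\<^sub>R (of_real (norm c) - c)"
  have "norm z = norm (of_real (norm c) - c) / q" using q by (simp add: z_def)
  also have "\<dots> \<le> norm c / q" using c q by (intro divide_right_mono) (auto simp: cpositive_def)
  also have "\<dots> < 1" using q by simp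
  finally have "norm z < 1" .
  then obtain s where s: "(1 - z) * s = 1" "s * (1 - z) = 1"
    using neumann_inverse[of UNIV z] by (auto simp: closed_subalgebra_def)
  have qz: "q *\<^sub>R z = of_real (norm c) - c" using q by (simp add: z_def)
  have e: "of_real r + c = q *\<^sub>R (1 - z)"
    using qz by (simp add: scaleR_diff_right q_def of_real_def scaleR_add_left)
  show ?thesis
    by (rule that[of "(1 / q) *\<^sub>R s"]) (use q s in \<open>simp_all add: e\<close>)
qed

text \<open>The fact that \<open>star y * y\<close> and \<open>y * star y\<close> have the same
  spectrum apart from 0, used at the single point r, the norm of \<open>p = y * star y\<close>.
  Adding both squares shows \<open>p\<close> positive, so some character takes the value r at
  \<open>p\<close> and r - p is not invertible; yet r - star y * y = r + c is.\<close>

lemma no_negative_hermitian_square: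
  fixes y :: "'a::cstar_algebra"
  assumes yc: "star y * y = - c" and c: "cpositive c"
  shows "y = 0"
proof (rule ccontr)
  assume "y \<noteq> 0"
  define p where "p = y * star y"
  define r where "r = norm p"
  have "r = (norm y)\<^sup>2" using cstar_identity[of "star y"] by (simp add: r_def p_def star_star)
  then have r: "r > 0" using \<open>y \<noteq> 0\<close> by simp
  have sp: "star p = p" by (simp add: p_def star_simps)
  define a b where "a = (1/2) *\<^sub>R (y + star y)" and "b = scaleC (- \<i> / 2) (y - star y)"
  have ab: "star a = a" "star b = b" "y = a + scaleC \<i> b"
    using sa_parts[of y] by (simp_all add: a_def b_def)
  have sy: "star y = a - scaleC \<i> b"
    using ab by (simp add: star_simps)
  have "star y * y + y * star y = 2 *\<^sub>R (a * a + b * b)"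
    unfolding sy unfolding ab(3)
    by (simp add: algebra_simps mult_scaleC_left mult_scaleC_right scaleC_scaleC scaleR_2)
  then have "p = 2 *\<^sub>R (a * a + b * b) + c" by (simp add: yc p_def algebra_simps)
  then have pp: "cpositive p"
    using ab c by (auto intro!: cpositive_add cpositive_scaleR cpositive_square)
  obtain u where u: "(of_real r + c) * u = 1" "u * (of_real r + c) = 1"
    using invertible_of_real_plus_positive[OF c r] by metis
  \<comment> \<open>Up to the factor 1 / r this is the inverse of r - p, by the classical formula
    that transports an inverse of 1 - ab to one of 1 - ba.\<close>
  define w where "w = 1 + y * u * star y"
  have rc: "of_real r + c = of_real r - star y * y" by (simp add: yc)
  have "(of_real r - p) * w = of_real r - p + y * ((of_real r + c) * u) * star y"
    unfolding w_def p_def rc by (simp add: algebra_simps of_real_mult_left_commute)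
  then have w1: "(of_real r - p) * w = of_real r" by (simp add: u p_def)
  have "w * (of_real r - p) = of_real r - p + y * (u * (of_real r + c)) * star y"
    unfolding w_def p_def rc
    by (simp add: algebra_simps of_real_mult_left_commute of_real_mult_commute[of r "y * (u * star y)"]
        of_real_mult_commute[of r "star y"])
  then have w2: "w * (of_real r - p) = of_real r" by (simp add: u p_def)
  let ?B = "commutant (commutant {p})"
  interpret abelian_inclusion ?B by (rule bicommutant_sa[OF sp])
  have pB: "p \<in> ?B" by (rule subset_bicommutant) simp
  \<comment> \<open>The character that attains the norm of \<open>p\<close> can be applied to
    \<open>w\<close> only once \<open>w\<close> is known to lie in the bicommutant.\<close>
  have "(1 / r) *\<^sub>R w \<in> ?B"
    by (rule bicommutant_inverse[of "of_real r - p"])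
      (use pB w1 w2 r in \<open>auto simp: of_real_def\<close>)
  then have wB: "w \<in> ?B" using r scaleR[of "(1 / r) *\<^sub>R w" r] by simp
  obtain \<tau> where \<tau>: "\<tau> \<in> characters ?B" "cmod (\<tau> p) = r"
    using gelfand_norm_attained[OF pB sp] by (auto simp: r_def)
  have "\<tau> p \<in> \<real>\<^sub>\<ge>\<^sub>0" by (rule character_cpositive[OF \<tau>(1) pB pp])
  then have "\<tau> p = of_real r" using \<tau>(2) by (auto elim: nonneg_Reals_cases)
  then have "\<tau> ((of_real r - p) * w) = 0"
    using \<tau>(1) pB wB by (simp add: character_mult character_diff character_of_real)
  then show False using w1 r \<tau>(1) by (simp add: character_of_real)
qed

text \<open>With \<open>k\<close> the absolute value of \<open>h\<close>, \<open>m = k - h\<close>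
  is twice the negative part. Then m h = - m^2 / 2, so the hermitian square of \<open>x * m\<close>
  is - m^3 / 2, and the previous lemma forces \<open>x * m = 0\<close>. Hence
  \<open>m * m = 0\<close>.\<close>

theorem cpositive_star_mult: "cpositive (star x * (x::'a::cstar_algebra))"
proof -
  define h where "h = star x * x"
  have sh: "star h = h" by (simp add: h_def star_simps)
  let ?B = "commutant (commutant {h})"
  interpret abelian_inclusion ?B by (rule bicommutant_sa[OF sh])
  have hB: "h \<in> ?B" by (rule subset_bicommutant) simp
  obtain k where k: "k \<in> ?B" "cpositive k" "k * k = h * h"
    "\<And>\<tau>. \<tau> \<in> characters ?B \<Longrightarrow> \<tau> k = of_real \<bar>Re (\<tau> h)\<bar>"
    using abs_exists[OF hB sh] by metis
  define m where "m = k - h"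
  have mB: "m \<in> ?B" and sm: "star m = m"
    using k hB sh by (auto simp: m_def star_diff cpositive_star)
  have m: "cpositive m"
  proof (rule cpositive_if_characters[OF mB sm])
    fix \<tau> assume \<tau>: "\<tau> \<in> characters ?B"
    have "\<tau> m = \<tau> k - \<tau> h" unfolding m_def by (rule character_diff[OF \<tau> k(1) hB])
    then show "Re (\<tau> m) \<ge> 0" using k(4)[OF \<tau>] by simp
  qed
  have kh: "k * h = h * k" using commute k(1) hB by blast
  have "m * (k + h) = 0" by (simp add: m_def algebra_simps kh k(3))
  then have mh: "2 *\<^sub>R (m * h) = - (m * m)"
    by (simp add: m_def algebra_simps scaleR_2)
  have "star (x * m) * (x * m) = m * h * m" by (simp add: star_mult sm h_def mult.assoc)
  also have "m * h = - ((1/2) *\<^sub>R (m * m))" using arg_cong[OF mh, of "\<lambda>z. (1/2) *\<^sub>R z"] by simp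
  finally have "star (x * m) * (x * m) = - ((1/2) *\<^sub>R (m * m * m))" by simp
  moreover have "cpositive ((1/2) *\<^sub>R (m * m * m))"
    using m by (intro cpositive_scaleR cpositive_mult) (auto simp: mult.assoc)
  ultimately have "x * m = 0" by (rule no_negative_hermitian_square)
  then have "h * m = 0" by (simp add: h_def mult.assoc)
  then have "m * h = 0" using commute[OF mB hB] by simp
  then have "m * m = 0" using mh by simp
  then have "m = 0" using norm_square_sa[OF sm] by simp
  then show ?thesis using k(2) by (simp add: m_def h_def)
qed

subsection \<open>States\<close>

definition sublinear :: "('a::real_vector \<Rightarrow> real) \<Rightarrow> bool" where
  "sublinear p \<longleftrightarrow> (\<forall>x y. p (x + y) \<le> p x + p y) \<and> (\<forall>r>0. \<forall>x. p (r *\<^sub>R x) \<le> r * p x)"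

lemma sublinear_add: "sublinear p \<Longrightarrow> p (x + y) \<le> p x + p y"
  by (simp add: sublinear_def)

lemma sublinear_scale:
  assumes "sublinear p" "r > 0" shows "p (r *\<^sub>R x) = r * p x"
proof -
  have "p ((1 / r) *\<^sub>R (r *\<^sub>R x)) \<le> (1 / r) * p (r *\<^sub>R x)"
    using assms unfolding sublinear_def by (meson zero_less_divide_1_iff)
  then have "r * p x \<le> p (r *\<^sub>R x)" using assms by (simp add: field_simps)
  moreover have "p (r *\<^sub>R x) \<le> r * p x" using assms by (simp add: sublinear_def)
  ultimately show ?thesis by simp
qed

lemma sublinear_0: "sublinear p \<Longrightarrow> p 0 = 0"
  using sublinear_scale[of p 2 0] by simp

lemma sublinear_lower: "sublinear p \<Longrightarrow> - p (- x) \<le> p x"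
  using sublinear_add[of p x "- x"] sublinear_0[of p] by simp

text \<open>Zorn's lemma downwards. Everything sublinear below \<open>p\<close> stays above - p (-
  x), so pointwise infima of nonempty chains are finite; subadditivity survives because two members
  of a chain have a common lower one.\<close>

lemma sublinear_minimal:
  fixes p :: "'a::real_vector \<Rightarrow> real"
  assumes p: "sublinear p"
  obtains q where "sublinear q" "q \<le> p" "\<And>s. sublinear s \<Longrightarrow> s \<le> q \<Longrightarrow> s = q"
proof -
  define A where "A = {q. sublinear q \<and> q \<le> p}"
  have "\<exists>m\<in>A. \<forall>a\<in>A. a \<le> m \<longrightarrow> a = m"
  proof (rule predicate_Zorn)
    show "partial_order_on A (relation_of (\<lambda>x y. y \<le> x) A)"
      by (rule partial_order_on_relation_ofI) auto
    fix C assume C: "C \<in> Chains (relation_of (\<lambda>x y. y \<le> x) A)"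
    show "\<exists>u\<in>A. \<forall>a\<in>C. u \<le> a"
    proof (cases "C = {}")
      case True
      then show ?thesis using p by (auto simp: A_def)
    next
      case False
      have CA: "sublinear q" "q \<le> p" if "q \<in> C" for q
        using C that unfolding Chains_def relation_of_def A_def by blast+
      have tot: "q \<le> s \<or> s \<le> q" if "q \<in> C" "s \<in> C" for q s
        using C that unfolding Chains_def relation_of_def by blast
      define u where "u x = (INF q\<in>C. q x)" for x
      have bdd: "bdd_below ((\<lambda>q. q x) ` C)" for x
      proof (rule bdd_belowI2)
        fix q assume "q \<in> C"
        then show "- p (- x) \<le> q x"
          using CA[of q] sublinear_lower[of q x] by (meson le_funD neg_le_iff_le order_trans)
      qed
      have u_le: "u \<le> q" if "q \<in> C" for q
        unfolding u_def by (rule le_funI) (rule cINF_lower[OF bdd that])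
      have u_ge: "b \<le> u x" if "\<And>q. q \<in> C \<Longrightarrow> b \<le> q x" for b x
        unfolding u_def by (rule cINF_greatest[OF False that])
      have "sublinear u" unfolding sublinear_def
      proof (intro conjI allI impI)
        fix x y
        have "u (x + y) - q1 x \<le> q2 y" if q12: "q1 \<in> C" "q2 \<in> C" for q1 q2
        proof -
          obtain q where q: "q \<in> C" "q \<le> q1" "q \<le> q2" using tot[OF q12] q12 by blast
          have "u (x + y) \<le> q (x + y)" using u_le[OF q(1)] by (rule le_funD)
          also have "\<dots> \<le> q x + q y" using CA(1)[OF q(1)] by (rule sublinear_add)
          also have "\<dots> \<le> q1 x + q2 y" using le_funD[OF q(2), of x] le_funD[OF q(3), of y] by linarith
          finally show ?thesis by simp
        qed
        then have "u (x + y) - q1 x \<le> u y" if "q1 \<in> C" for q1 using that by (intro u_ge)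
        then have "u (x + y) - u y \<le> q1 x" if "q1 \<in> C" for q1 using that by (simp add: algebra_simps)
        then have "u (x + y) - u y \<le> u x" by (rule u_ge)
        then show "u (x + y) \<le> u x + u y" by simp
      next
        fix r :: real and x assume r: "r > 0"
        have "u (r *\<^sub>R x) / r \<le> q x" if "q \<in> C" for q
          using le_funD[OF u_le[OF that], of "r *\<^sub>R x"] sublinear_scale[OF CA(1)[OF that] r, of x] r
          by (simp add: field_simps)
        then have "u (r *\<^sub>R x) / r \<le> u x" by (rule u_ge)
        then show "u (r *\<^sub>R x) \<le> r * u x" using r by (simp add: field_simps)
      qed
      moreover obtain q where "q \<in> C" using False by blast
      then have "u \<le> p" using u_le[of q] CA(2)[of q] by (meson order_trans)
      ultimately show ?thesis using u_le by (auto simp: A_def)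
    qed
  qed
  then obtain m where m: "m \<in> A" "\<And>a. a \<in> A \<Longrightarrow> a \<le> m \<Longrightarrow> a = m" by blast
  show ?thesis
  proof (rule that[of m])
    show "sublinear m" "m \<le> p" using m(1) by (simp_all add: A_def)
    fix s assume s: "sublinear s" "s \<le> m"
    then have "s \<in> A" using \<open>m \<le> p\<close> by (simp add: A_def)
    then show "s = m" using m(2) s(2) by simp
  qed
qed

text \<open>
  A minimal sublinear functional \<open>q\<close> is additive because it coincides with
  \<open>\<lambda>x. INF t. q (x + t y) - t q y\<close>, which is again sublinear and lies below \<open>q\<close>.
\<close>

theorem hahn_banach:
  fixes p :: "'a::real_vector \<Rightarrow> real"
  assumes "sublinear p"
  obtains f where "linear f" "\<And>x. f x \<le> p x"
proof -
  obtain q where q: "sublinear q" "q \<le> p" "\<And>s. sublinear s \<Longrightarrow> s \<le> q \<Longrightarrow> s = q"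
    using sublinear_minimal[OF assms] by blast
  have super: "q x + q y \<le> q (x + y)" for x y
  proof -
    define s where "s x = (INF t\<in>{0..}. q (x + t *\<^sub>R y) - t * q y)" for x
    have hom: "q (t *\<^sub>R y) = t * q y" if "t \<ge> 0" for t
      using that sublinear_scale[OF q(1), of t y] sublinear_0[OF q(1)] by (cases "t = 0") auto
    have bdd: "bdd_below ((\<lambda>t. q (x + t *\<^sub>R y) - t * q y) ` {0..})" for x
    proof (rule bdd_belowI2)
      fix t :: real assume "t \<in> {0..}"
      then show "- q (- x) \<le> q (x + t *\<^sub>R y) - t * q y"
        using sublinear_add[OF q(1), of "x + t *\<^sub>R y" "- x"] hom[of t] by simp
    qed
    have s_le: "s x \<le> q (x + t *\<^sub>R y) - t * q y" if "t \<ge> 0" for x t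
      unfolding s_def using that by (intro cINF_lower[OF bdd]) simp
    have s_ge: "b \<le> s x" if "\<And>t. t \<ge> 0 \<Longrightarrow> b \<le> q (x + t *\<^sub>R y) - t * q y" for b x
      unfolding s_def using that by (intro cINF_greatest) auto
    have "sublinear s" unfolding sublinear_def
    proof (intro conjI allI impI)
      fix x z
      have "s (x + z) - (q (x + t1 *\<^sub>R y) - t1 * q y) \<le> q (z + t2 *\<^sub>R y) - t2 * q y"
        if "t1 \<ge> 0" "t2 \<ge> 0" for t1 t2
      proof -
        have "s (x + z) \<le> q ((x + z) + (t1 + t2) *\<^sub>R y) - (t1 + t2) * q y"
          using that by (intro s_le) simp
        also have "(x + z) + (t1 + t2) *\<^sub>R y = (x + t1 *\<^sub>R y) + (z + t2 *\<^sub>R y)"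
          by (simp add: scaleR_add_left)
        also have "q \<dots> \<le> q (x + t1 *\<^sub>R y) + q (z + t2 *\<^sub>R y)" by (rule sublinear_add[OF q(1)])
        finally show ?thesis by (simp add: algebra_simps)
      qed
      then have "s (x + z) - (q (x + t1 *\<^sub>R y) - t1 * q y) \<le> s z" if "t1 \<ge> 0" for t1
        using that by (intro s_ge)
      then have "s (x + z) - s z \<le> q (x + t1 *\<^sub>R y) - t1 * q y" if "t1 \<ge> 0" for t1
        using that by (simp add: algebra_simps)
      then have "s (x + z) - s z \<le> s x" by (rule s_ge)
      then show "s (x + z) \<le> s x + s z" by simp
    next
      fix r :: real and x assume r: "r > 0"
      have "s (r *\<^sub>R x) / r \<le> q (x + t *\<^sub>R y) - t * q y" if "t \<ge> 0" for t
      proof -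
        have "s (r *\<^sub>R x) \<le> q (r *\<^sub>R x + (r * t) *\<^sub>R y) - (r * t) * q y"
          using r that by (intro s_le) simp
        also have "r *\<^sub>R x + (r * t) *\<^sub>R y = r *\<^sub>R (x + t *\<^sub>R y)" by (simp add: scaleR_add_right)
        also have "q \<dots> = r * q (x + t *\<^sub>R y)" by (rule sublinear_scale[OF q(1) r])
        finally show ?thesis using r by (simp add: field_simps)
      qed
      then have "s (r *\<^sub>R x) / r \<le> s x" by (rule s_ge)
      then show "s (r *\<^sub>R x) \<le> r * s x" using r by (simp add: field_simps)
    qed
    moreover have "s \<le> q" by (rule le_funI) (use s_le[of 0] in simp)
    ultimately have "s = q" by (rule q(3))
    then show ?thesis using s_le[of 1 x] by simp
  qed
  have add: "q (x + y) = q x + q y" for x y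
    using super[of x y] sublinear_add[OF q(1), of x y] by simp
  have neg: "q (- x) = - q x" for x
    using add[of x "- x"] sublinear_0[OF q(1)] by simp
  have "linear q"
  proof (rule linearI)
    show "q (r *\<^sub>R x) = r *\<^sub>R q x" for r x
    proof (cases r "0::real" rule: linorder_cases)
      case less
      then show ?thesis using sublinear_scale[OF q(1), of "- r" x] neg[of "r *\<^sub>R x"] by simp
    next
      case equal
      then show ?thesis using sublinear_0[OF q(1)] by simp
    next
      case greater
      then show ?thesis using sublinear_scale[OF q(1)] by simp
    qed
  qed (rule add)
  then show ?thesis using that q(2) by (metis le_funD)
qed

section \<open>From characters to states\<close>

lemma scaleC_eq_re_im: "scaleC c x = Re c *\<^sub>R x + Im c *\<^sub>R scaleC \<i> (x::'a::cstar_algebra)"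
proof -
  have "scaleC c x = scaleC (of_real (Re c) + of_real (Im c) * \<i>) x"
    by (simp add: complex_eq_iff)
  also have "\<dots> = Re c *\<^sub>R x + Im c *\<^sub>R scaleC \<i> x"
    by (simp only: scaleC_add_left scaleC_scaleC[symmetric] scaleC_of_real)
  finally show ?thesis .
qed

text \<open>The norm form of positivity is made for this: for \<open>a = star x * x\<close> a
  contractive unital functional sends \<open>norm (of_real (norm a) - a) \<le> norm a\<close> to a
  bound that keeps the real part of \<open>\<phi> a\<close> nonnegative.\<close>

lemma hermitian_square_nonneg_if_contractive:
  fixes \<phi> :: "'a::cstar_algebra \<Rightarrow> complex"
  assumes lin: "\<And>x y. \<phi> (x + y) = \<phi> x + \<phi> y" "\<And>c x. \<phi> (scaleC c x) = c * \<phi> x"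
    and one: "\<phi> 1 = 1" and contr: "\<And>x. cmod (\<phi> x) \<le> norm x"
  shows "\<phi> (star x * x) \<in> \<real>\<^sub>\<ge>\<^sub>0"
proof -
  define a where "a = star x * x"
  have a: "star a = a" "norm (of_real (norm a) - a) \<le> norm a"
    using cpositive_star_mult[of x] by (auto simp: cpositive_def a_def)
  have r: "\<phi> (of_real t) = of_real t" for t
    using lin(2)[of "of_real t" 1] one by (simp add: of_real_eq_scaleC)
  have "\<phi> (scaleC (- 1) a) = - \<phi> a" unfolding lin(2) by simp
  then have m: "\<phi> (- a) = - \<phi> a" by simp
  have Im: "Im (\<phi> a) = 0"
  proof (rule sa_real_of_norm_bound[OF a(1)])
    fix t :: real
    show "cmod (\<phi> a + \<i> * of_real t) \<le> norm (a + scaleC \<i> (of_real t))"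
      using contr[of "a + scaleC \<i> (of_real t)"] by (simp add: lin r)
  qed
  have "cmod (\<phi> (of_real (norm a) + - a)) \<le> norm a"
    using contr[of "of_real (norm a) + - a"] a(2) by simp
  then have "cmod (of_real (norm a) - \<phi> a) \<le> norm a" unfolding lin(1) r m by simp
  then have "Re (of_real (norm a) - \<phi> a) \<le> norm a"
    using complex_Re_le_cmod order_trans by blast
  then have "Re (\<phi> a) \<ge> 0" by simp
  with Im show ?thesis unfolding a_def by (simp add: complex_nonneg_Reals_iff)
qed

context abelian_inclusion
begin

theorem state_extension:
  assumes \<sigma>: "\<sigma> \<in> characters B"
  obtains \<phi> where "state \<phi>" "\<And>d. d \<in> B \<Longrightarrow> \<phi> d = \<sigma> d"
proof -
  \<comment> \<open>The infimal convolution of the norm and Re \<sigma>. A linear functional below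
    it is below the norm (take d = 0) and below Re \<sigma> on \<open>B\<close> (take d = x), thus
    equal to Re \<sigma> there by a change of sign. One domination gives both extension and
    contractivity.\<close>
  define p where "p x = (INF d\<in>B. norm (x - d) + Re (\<sigma> d))" for x
  have Re_le: "- norm d \<le> Re (\<sigma> d)" if "d \<in> B" for d
    using character_norm_le[OF \<sigma> that] abs_Re_le_cmod[of "\<sigma> d"] by linarith
  have bdd: "bdd_below ((\<lambda>d. norm (x - d) + Re (\<sigma> d)) ` B)" for x
  proof (rule bdd_belowI2)
    fix d assume "d \<in> B"
    then show "- norm x \<le> norm (x - d) + Re (\<sigma> d)"
      using Re_le norm_triangle_sub[of d x] by (smt (verit) norm_minus_commute)
  qed
  have p_le: "p x \<le> norm (x - d) + Re (\<sigma> d)" if "d \<in> B" for x d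
    unfolding p_def by (rule cINF_lower[OF bdd that])
  have p_ge: "b \<le> p x" if "\<And>d. d \<in> B \<Longrightarrow> b \<le> norm (x - d) + Re (\<sigma> d)" for b x
    unfolding p_def by (rule cINF_greatest) (use zero that in blast)+
  have "sublinear p" unfolding sublinear_def
  proof (intro conjI allI impI)
    fix x y
    have "p (x + y) - (norm (x - d) + Re (\<sigma> d)) \<le> norm (y - e) + Re (\<sigma> e)"
      if "d \<in> B" "e \<in> B" for d e
    proof -
      have "p (x + y) \<le> norm ((x + y) - (d + e)) + Re (\<sigma> (d + e))" using that by (intro p_le) simp
      moreover have "norm ((x + y) - (d + e)) \<le> norm (x - d) + norm (y - e)"
        using norm_triangle_ineq[of "x - d" "y - e"] by (simp add: algebra_simps)
      ultimately show ?thesis using that by (simp add: character_add[OF \<sigma>])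
    qed
    then have "p (x + y) - (norm (x - d) + Re (\<sigma> d)) \<le> p y" if "d \<in> B" for d
      using that by (intro p_ge)
    then have "p (x + y) - p y \<le> norm (x - d) + Re (\<sigma> d)" if "d \<in> B" for d
      using that by (simp add: algebra_simps)
    then have "p (x + y) - p y \<le> p x" by (rule p_ge)
    then show "p (x + y) \<le> p x + p y" by simp
  next
    fix r :: real and x assume r: "r > 0"
    have "p (r *\<^sub>R x) / r \<le> norm (x - d) + Re (\<sigma> d)" if d: "d \<in> B" for d
    proof -
      have "p (r *\<^sub>R x) \<le> norm (r *\<^sub>R x - r *\<^sub>R d) + Re (\<sigma> (r *\<^sub>R d))"
        using d by (intro p_le) simp
      also have "norm (r *\<^sub>R x - r *\<^sub>R d) = r * norm (x - d)"
        using r by (simp flip: scaleR_diff_right)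
      also have "Re (\<sigma> (r *\<^sub>R d)) = r * Re (\<sigma> d)" using d by (simp add: character_scaleR[OF \<sigma>])
      finally show ?thesis using r by (simp add: field_simps)
    qed
    then have "p (r *\<^sub>R x) / r \<le> p x" by (rule p_ge)
    then show "p (r *\<^sub>R x) \<le> r * p x" using r by (simp add: field_simps)
  qed
  then obtain f where f: "linear f" "\<And>x. f x \<le> p x" using hahn_banach by blast
  interpret f: linear f by (rule f(1))
  have f_norm: "f x \<le> norm x" for x
    using f(2)[of x] p_le[OF zero, of x] by (simp add: character_0[OF \<sigma>])
  have f_le: "f d \<le> Re (\<sigma> d)" if "d \<in> B" for d
    using f(2)[of d] p_le[OF that, of d] by simp
  have f_eq: "f d = Re (\<sigma> d)" if "d \<in> B" for d
    using f_le[OF that] f_le[of "- d"] that by (simp add: character_minus[OF \<sigma>] f.neg)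
  \<comment> \<open>The complex linear functional with real part \<open>f\<close>.\<close>
  define \<phi> where "\<phi> x = Complex (f x) (- f (scaleC \<i> x))" for x
  have add: "\<phi> (x + y) = \<phi> x + \<phi> y" for x y
    by (simp add: \<phi>_def f.add scaleC_add_right complex_eq_iff)
  have sc: "\<phi> (scaleC c x) = c * \<phi> x" for c x
  proof -
    have "scaleC \<i> (scaleC c x) = Re c *\<^sub>R scaleC \<i> x - Im c *\<^sub>R x"
      using scaleC_eq_re_im[of "\<i> * c" x] by (simp add: scaleC_scaleC)
    then show ?thesis unfolding \<phi>_def
      by (subst scaleC_eq_re_im) (simp add: f.add f.diff f.scale complex_eq_iff)
  qed
  have ext: "\<phi> d = \<sigma> d" if "d \<in> B" for d
    using that by (simp add: \<phi>_def f_eq character_scaleC[OF \<sigma>] complex_eq_iff)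
  have contr: "cmod (\<phi> x) \<le> norm x" for x
  proof (cases "\<phi> x = 0")
    case False
    define u where "u = cnj (\<phi> x) / cmod (\<phi> x)"
    have "cnj (\<phi> x) * \<phi> x = of_real (cmod (\<phi> x)) * of_real (cmod (\<phi> x))"
      using complex_norm_square[of "\<phi> x"] by (simp add: power2_eq_square mult.commute)
    then have u: "cmod u = 1" "u * \<phi> x = of_real (cmod (\<phi> x))"
      using False by (simp_all add: u_def norm_divide)
    have "cmod (\<phi> x) = Re (\<phi> (scaleC u x))" by (simp add: sc u)
    also have "\<dots> = f (scaleC u x)" by (simp add: \<phi>_def)
    also have "\<dots> \<le> norm (scaleC u x)" by (rule f_norm)
    finally show ?thesis by (simp add: norm_scaleC u)
  qed simp
  have one: "\<phi> 1 = 1" using ext[OF one] character_1[OF \<sigma>] by simp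
  have "state \<phi>" unfolding state_def Vector_Spaces.linear_iff
    using hermitian_square_nonneg_if_contractive[OF add sc one contr] add sc one
      vector_space_scaleC vector_space_over_itself.vector_space_axioms
    by blast
  with ext that show ?thesis by blast
qed

end

section \<open>Cauchy-Schwarz and multiplicativity of extensions over the subalgebra\<close>

lemma
  assumes "state \<phi>"
  shows state_add: "\<phi> (x + y) = \<phi> x + \<phi> y" and state_scaleC: "\<phi> (scaleC c x) = c * \<phi> x"
    and state_1: "\<phi> 1 = 1" and state_nonneg: "\<phi> (star x * x) \<in> \<real>\<^sub>\<ge>\<^sub>0"
  using assms unfolding state_def Vector_Spaces.linear_iff by auto

lemma
  assumes "state \<phi>"
  shows state_diff: "\<phi> (x - y) = \<phi> x - \<phi> y"
    and state_of_real: "\<phi> (of_real r) = of_real r" and state_scaleR: "\<phi> (r *\<^sub>R x) = of_real r * \<phi> x"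
proof -
  have "\<phi> (scaleC (- 1) x) = - \<phi> x" for x unfolding state_scaleC[OF assms] by simp
  then have m: "\<phi> (- x) = - \<phi> x" for x by simp
  show "\<phi> (x - y) = \<phi> x - \<phi> y" using state_add[OF assms, of x "- y"] m by simp
  show s: "\<phi> (r *\<^sub>R x) = of_real r * \<phi> x" for x
    using state_scaleC[OF assms, of "of_real r" x] by (simp only: scaleC_of_real)
  show "\<phi> (of_real r) = of_real r" using s[of 1] state_1[OF assms] by (simp add: of_real_def)
qed

lemma state_Im: "state \<phi> \<Longrightarrow> Im (\<phi> (star x * x)) = 0"
  and state_Re: "state \<phi> \<Longrightarrow> Re (\<phi> (star x * x)) \<ge> 0"
  using state_nonneg[of \<phi> x] by (auto simp: complex_nonneg_Reals_iff)

lemma state_hermitian: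
  assumes "state \<phi>" shows "\<phi> (star y * x) = cnj (\<phi> (star x * y))"
proof -
  have "star (x + y) * (x + y) = star x * x + star y * y + (star x * y + star y * x)"
    by (simp add: star_add algebra_simps)
  then have "Im (\<phi> (star x * x + star y * y + (star x * y + star y * x))) = 0"
    using state_Im[OF assms, of "x + y"] by simp
  then have 1: "Im (\<phi> (star x * y)) + Im (\<phi> (star y * x)) = 0"
    by (simp add: state_add[OF assms] state_Im[OF assms])
  have "star (x + scaleC \<i> y) * (x + scaleC \<i> y)
      = star x * x + star y * y + scaleC \<i> (star x * y - star y * x)"
    by (simp add: star_simps algebra_simps mult_scaleC_left mult_scaleC_right scaleC_scaleC
        scaleC.scale_right_diff_distrib)
  then have "Im (\<phi> (star x * x + star y * y + scaleC \<i> (star x * y - star y * x))) = 0"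
    using state_Im[OF assms, of "x + scaleC \<i> y"] by simp
  then have "Re (\<phi> (star x * y)) - Re (\<phi> (star y * x)) = 0"
    by (simp add: state_add[OF assms] state_Im[OF assms] state_scaleC[OF assms] state_diff[OF assms])
  with 1 show ?thesis by (simp add: complex_eq_iff)
qed

lemma state_Cauchy_Schwarz:
  assumes \<phi>: "state \<phi>"
  shows "(cmod (\<phi> (star x * y)))\<^sup>2 \<le> Re (\<phi> (star x * x)) * Re (\<phi> (star y * y))"
proof -
  define A C b where "A = Re (\<phi> (star x * x))" and "C = Re (\<phi> (star y * y))" and "b = \<phi> (star x * y)"
  have AC: "\<phi> (star x * x) = of_real A" "\<phi> (star y * y) = of_real C" "A \<ge> 0" "C \<ge> 0"
    using state_Im[OF \<phi>] state_Re[OF \<phi>] by (auto simp: A_def C_def complex_eq_iff)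
  have hb: "\<phi> (star y * x) = cnj b" unfolding b_def by (rule state_hermitian[OF \<phi>])
  define B where "B = (cmod b)\<^sup>2"
  have bb: "b * cnj b = of_real B" unfolding B_def by (rule complex_norm_square[symmetric])
  have quad: "A - 2 * t * B + t\<^sup>2 * B * C \<ge> 0" for t :: real
  proof -
    \<comment> \<open>The factor \<open>cnj b\<close> makes both cross terms equal to -t B, leaving
      a real quadratic in t.\<close>
    define l where "l = - (of_real t * cnj b)"
    let ?w = "x + scaleC l y"
    have "star ?w * ?w = star x * x + scaleC l (star x * y) + scaleC (cnj l) (star y * x)
        + scaleC (cnj l * l) (star y * y)"
      by (simp add: star_add star_scaleC algebra_simps mult_scaleC_left mult_scaleC_right
          scaleC_scaleC scaleC_add_right)
    then have "\<phi> (star ?w * ?w) = of_real A + l * b + cnj l * cnj b + cnj l * l * of_real C"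
      by (simp add: state_add[OF \<phi>] state_scaleC[OF \<phi>] AC hb b_def)
    also have "l * b = - (of_real t * (b * cnj b))" by (simp add: l_def)
    also have "cnj l * cnj b = - (of_real t * (b * cnj b))" by (simp add: l_def)
    also have "cnj l * l = of_real (t\<^sup>2) * (b * cnj b)"
      by (simp add: l_def power2_eq_square)
    finally have "\<phi> (star ?w * ?w) = of_real (A - 2 * t * B + t\<^sup>2 * B * C)"
      unfolding bb by simp
    then show ?thesis using state_Re[OF \<phi>, of ?w] by (metis Re_complex_of_real)
  qed
  have "B \<le> A * C"
  proof (cases "C = 0")
    case True
    have "B = 0"
    proof (rule ccontr)
      assume nz: "B \<noteq> 0"
      \<comment> \<open>For C = 0 the quadratic is A - 2 t B, and this t gives it the value
        -1.\<close>
      then show False using quad[of "(A + 1) / (2 * B)"] True by simp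
    qed
    then show ?thesis using True by simp
  next
    case False
    then have "C > 0" using AC by simp
    then have "0 \<le> C * (A - 2 * (1 / C) * B + (1 / C)\<^sup>2 * B * C)"
      using quad[of "1 / C"] by simp
    also have "\<dots> = A * C - B" using \<open>C > 0\<close> by (simp add: field_simps power2_eq_square)
    finally show ?thesis by simp
  qed
  then show ?thesis by (simp add: A_def B_def C_def b_def)
qed

lemma state_norm_le:
  assumes \<phi>: "state \<phi>" shows "cmod (\<phi> x) \<le> norm x"
proof -
  have sx: "star (star x * x) = star x * x" by (simp add: star_simps)
  have n: "norm (star x * x) = (norm x)\<^sup>2" by (rule cstar_identity)
  have "cpositive (of_real ((norm x)\<^sup>2) - star x * x)"
    by (rule cpositive_of_real_minus[OF sx]) (simp add: n)
  then obtain s where s: "cpositive s" "s * s = of_real ((norm x)\<^sup>2) - star x * x"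
    using cpositive_obtain_sqrt by blast
  have "Re (\<phi> (star s * s)) \<ge> 0" by (rule state_Re[OF \<phi>])
  also have "\<phi> (star s * s) = of_real ((norm x)\<^sup>2) - \<phi> (star x * x)"
    by (simp only: cpositive_star[OF s(1)] s(2) state_diff[OF \<phi>] state_of_real[OF \<phi>])
  finally have "Re (\<phi> (star x * x)) \<le> (norm x)\<^sup>2" by simp
  moreover have "(cmod (\<phi> x))\<^sup>2 \<le> Re (\<phi> (star x * x))"
    using state_Cauchy_Schwarz[OF \<phi>, of 1 x] by (simp add: state_1[OF \<phi>])
  ultimately have "(cmod (\<phi> x))\<^sup>2 \<le> (norm x)\<^sup>2" by linarith
  then show ?thesis by (rule power2_le_imp_le) simp
qed

lemma bounded_linear_state: "state \<phi> \<Longrightarrow> bounded_linear \<phi>"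
  by (rule bounded_linear_intro[of _ 1])
    (simp_all add: state_add state_scaleR state_norm_le scaleR_conv_of_real[where 'a = complex])

context abelian_inclusion
begin

text \<open>The multiplicative domain argument: z = d - \<sigma>(d) 1 satisfies \<phi>(z^* z) = 0,
  since \<phi> is a character on \<open>B\<close>, and Cauchy-Schwarz then kills \<phi>(x z) for
  every \<open>x\<close> in the whole algebra. The left version follows by taking adjoints.\<close>

lemma
  assumes \<phi>: "state \<phi>" and \<sigma>: "\<sigma> \<in> characters B" and ext: "\<And>d. d \<in> B \<Longrightarrow> \<phi> d = \<sigma> d"
    and d: "d \<in> B"
  shows state_mult_right: "\<phi> (x * d) = \<phi> x * \<sigma> d" and state_mult_left: "\<phi> (d * x) = \<sigma> d * \<phi> x"
proof -
  have *: "\<phi> (x * d) = \<phi> x * \<sigma> d" if d: "d \<in> B" for x d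
  proof -
    define z where "z = d - scaleC (\<sigma> d) 1"
    have z: "z \<in> B" "\<sigma> z = 0"
      using d by (simp_all add: z_def character_diff[OF \<sigma>] character_scaleC[OF \<sigma>] character_1[OF \<sigma>])
    have "\<phi> (star z * z) = 0" using z by (simp add: ext character_mult[OF \<sigma>])
    then have "\<phi> (x * z) = 0"
      using state_Cauchy_Schwarz[OF \<phi>, of "star x" z] by (simp add: star_star)
    then show ?thesis
      by (simp add: z_def algebra_simps mult_scaleC_right state_diff[OF \<phi>] state_scaleC[OF \<phi>])
  qed
  then show "\<phi> (x * d) = \<phi> x * \<sigma> d" using d by blast
  have "\<phi> (d * x) = cnj (\<phi> (star x * star d))"
    using state_hermitian[OF \<phi>, of "star d" x] by (simp add: star_star)
  also have "\<dots> = cnj (\<phi> (star x)) * \<sigma> d"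
    using *[of "star d" "star x"] d by (simp add: character_star[OF \<sigma>])
  also have "cnj (\<phi> (star x)) = \<phi> x"
    using state_hermitian[OF \<phi>, of 1 x] by simp
  finally show "\<phi> (d * x) = \<sigma> d * \<phi> x" by (simp add: mult.commute)
qed

end

subsection \<open>The character space\<close>

lemma continuous_map_mult_complex:
  fixes f g :: "'b \<Rightarrow> complex"
  assumes "continuous_map X euclidean f" "continuous_map X euclidean g"
  shows "continuous_map X euclidean (\<lambda>x. f x * g x)"
  using assms by (simp add: continuous_map_atin tendsto_mult)

lemma continuous_map_add_complex:
  fixes f g :: "'b \<Rightarrow> complex"
  assumes "continuous_map X euclidean f" "continuous_map X euclidean g"
  shows "continuous_map X euclidean (\<lambda>x. f x + g x)"
  using assms by (simp add: continuous_map_atin tendsto_add)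

lemma closedin_eq_complex:
  fixes f g :: "'b \<Rightarrow> complex"
  assumes "continuous_map X euclidean f" "continuous_map X euclidean g"
  shows "closedin X {x \<in> topspace X. f x = g x}"
  using assms by (intro closedin_continuous_maps_eq[of euclidean]) auto

lemma closedin_Ball:
  assumes "\<And>i. i \<in> I \<Longrightarrow> closedin X {x \<in> topspace X. P i x}"
  shows "closedin X {x \<in> topspace X. \<forall>i\<in>I. P i x}"
proof (cases "I = {}")
  case False
  have "{x \<in> topspace X. \<forall>i\<in>I. P i x} = (\<Inter>i\<in>I. {x \<in> topspace X. P i x})"
    using False by auto
  then show ?thesis using assms False by (auto intro!: closedin_INT)
qed simp

lemma closedin_conj:
  assumes "closedin X {x \<in> topspace X. P x}" "closedin X {x \<in> topspace X. Q x}"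
  shows "closedin X {x \<in> topspace X. P x \<and> Q x}"
proof -
  have "{x \<in> topspace X. P x \<and> Q x} = {x \<in> topspace X. P x} \<inter> {x \<in> topspace X. Q x}" by auto
  then show ?thesis using assms by (simp add: closedin_Int)
qed

context abelian_inclusion
begin

abbreviation (input) "P \<equiv> product_topology (\<lambda>_. euclidean :: complex topology) B"

lemma continuous_evaluation: "d \<in> B \<Longrightarrow> continuous_map (character_space B) euclidean (\<lambda>\<sigma>. \<sigma> d)"
  unfolding character_space_def
  by (intro continuous_map_from_subtopology continuous_map_product_projection)

lemma closedin_characters: "closedin P (characters B)"
proof -
  have top: "topspace P = extensional B" by (auto simp: PiE_def)
  have ev: "continuous_map P euclidean (\<lambda>\<sigma>. \<sigma> d)" if "d \<in> B" for d
    using that by (rule continuous_map_product_projection)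
  \<comment> \<open>Being nonzero is not a closed condition; for multiplicative functionals it is
    replaced by the equivalent \<sigma>(1) = 1, which is.\<close>
  have "characters B = {\<sigma> \<in> topspace P.
      (\<forall>x\<in>B. \<forall>y\<in>B. \<sigma> (x + y) = \<sigma> x + \<sigma> y) \<and>
      (\<forall>a\<in>UNIV. \<forall>x\<in>B. \<sigma> (scaleC a x) = a * \<sigma> x) \<and>
      (\<forall>x\<in>B. \<forall>y\<in>B. \<sigma> (x * y) = \<sigma> x * \<sigma> y) \<and> \<sigma> 1 = 1}" (is "_ = ?R")
  proof
    show "characters B \<subseteq> ?R" using character_1 unfolding top by (auto simp: characters_def)
    show "?R \<subseteq> characters B" unfolding top
    proof
      fix \<sigma> assume "\<sigma> \<in> {\<sigma> \<in> extensional B.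
        (\<forall>x\<in>B. \<forall>y\<in>B. \<sigma> (x + y) = \<sigma> x + \<sigma> y) \<and>
        (\<forall>a\<in>UNIV. \<forall>x\<in>B. \<sigma> (scaleC a x) = a * \<sigma> x) \<and>
        (\<forall>x\<in>B. \<forall>y\<in>B. \<sigma> (x * y) = \<sigma> x * \<sigma> y) \<and> \<sigma> 1 = 1}"
      moreover from this have "\<exists>x\<in>B. \<sigma> x \<noteq> 0" by (intro bexI[of _ 1]) simp_all
      ultimately show "\<sigma> \<in> characters B" by (simp add: characters_def)
    qed
  qed
  also have "closedin P \<dots>"
    by (intro closedin_conj closedin_Ball closedin_eq_complex continuous_map_mult_complex
        continuous_map_add_complex ev) simp_all
  finally show ?thesis .
qed

lemma compact_character_space: "compact_space (character_space B)"
proof -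
  have "compactin P (PiE B (\<lambda>d. cball 0 (norm d)))"
    unfolding compactin_PiE by (simp add: compactin_euclidean_iff)
  moreover have "characters B \<subseteq> PiE B (\<lambda>d. cball 0 (norm d))"
  proof
    fix \<sigma> assume \<sigma>: "\<sigma> \<in> characters B"
    then have "\<sigma> \<in> extensional B" by (simp add: characters_def)
    then show "\<sigma> \<in> PiE B (\<lambda>d. cball 0 (norm d))"
      using character_norm_le[OF \<sigma>] by (simp add: PiE_def Pi_def)
  qed
  ultimately have "compactin P (characters B)"
    using closed_compactin closedin_characters by blast
  then show ?thesis unfolding character_space_def by (rule compact_space_subtopology)
qed

lemma Hausdorff_character_space: "Hausdorff_space (character_space B)"
  unfolding character_space_def
  by (intro Hausdorff_space_subtopology) (simp add: Hausdorff_space_product_topology)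

text \<open>\<open>k\<close> is the Gelfand transform e^2 - |\<tau>(i) - \<sigma>(i)|^2, and adding
  its absolute value leaves twice its positive part: nonzero at \<sigma> and zero outside the disc
  of radius e.\<close>

lemma bump_coordinate:
  assumes \<sigma>: "\<sigma> \<in> characters B" and i: "i \<in> B" and U: "open U" "\<sigma> i \<in> U"
  obtains d where "d \<in> B" "\<sigma> d \<noteq> 0" "\<And>\<tau>. \<tau> \<in> characters B \<Longrightarrow> \<tau> i \<notin> U \<Longrightarrow> \<tau> d = 0"
proof -
  obtain e where e: "e > 0" "ball (\<sigma> i) e \<subseteq> U" using U by (meson openE)
  define g where "g = i - scaleC (\<sigma> i) 1"
  define k where "k = of_real (e\<^sup>2) - star g * g"
  have gB: "g \<in> B" using i by (simp add: g_def)
  have kB: "k \<in> B" "star k = k" using gB by (simp_all add: k_def star_simps del: of_real_power)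
  have \<tau>k: "\<tau> k = of_real (e\<^sup>2 - (cmod (\<tau> i - \<sigma> i))\<^sup>2)" if \<tau>: "\<tau> \<in> characters B" for \<tau>
  proof -
    have "\<tau> g = \<tau> i - \<sigma> i" unfolding g_def
      using i by (simp add: character_diff[OF \<tau>] character_scaleC[OF \<tau>] character_1[OF \<tau>])
    moreover have "\<tau> (star g * g) = cnj (\<tau> g) * \<tau> g"
      using gB by (simp add: character_mult[OF \<tau>] character_star[OF \<tau>])
    moreover have "\<tau> k = of_real (e\<^sup>2) - \<tau> (star g * g)" unfolding k_def
      using character_diff[OF \<tau> of_real mult[OF star[OF gB] gB]]
      by (simp only: character_of_real[OF \<tau>])
    ultimately show ?thesis
      by (simp only: complex_norm_square of_real_diff mult.commute)
  qed
  obtain m where m: "m \<in> B" "\<And>\<tau>. \<tau> \<in> characters B \<Longrightarrow> \<tau> m = of_real \<bar>Re (\<tau> k)\<bar>"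
    using abs_exists[OF kB] by metis
  have \<tau>d: "\<tau> (k + m) = of_real (r + \<bar>r\<bar>)"
    if \<tau>: "\<tau> \<in> characters B" and "r = e\<^sup>2 - (cmod (\<tau> i - \<sigma> i))\<^sup>2" for \<tau> r
    using \<tau>k[OF \<tau>] m(2)[OF \<tau>] character_add[OF \<tau> kB(1) m(1)] that(2)
    by (simp only: Re_complex_of_real of_real_add)
  show ?thesis
  proof (rule that[of "k + m"])
    show "k + m \<in> B" using kB m by simp
    show "\<sigma> (k + m) \<noteq> 0" using \<tau>d[OF \<sigma> refl] e(1) by simp
    fix \<tau> assume \<tau>: "\<tau> \<in> characters B" and "\<tau> i \<notin> U"
    then have "\<tau> i \<notin> ball (\<sigma> i) e" using e(2) by blast
    then have "e \<le> cmod (\<tau> i - \<sigma> i)" by (simp add: dist_norm norm_minus_commute)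
    then have "e\<^sup>2 \<le> (cmod (\<tau> i - \<sigma> i))\<^sup>2" using e(1) by (intro power_mono) auto
    then show "\<tau> (k + m) = 0" using \<tau>d[OF \<tau> refl] by simp
  qed
qed

text \<open>Urysohn functions coming from the algebra itself. A basic neighbourhood restricts only
  finitely many coordinates, and the product of the coordinate bumps vanishes as soon as one
  restriction fails.\<close>

lemma bump:
  assumes W: "openin (character_space B) W" and \<sigma>: "\<sigma> \<in> W"
  obtains d where "d \<in> B" "\<sigma> d \<noteq> 0" "\<And>\<tau>. \<tau> \<in> characters B - W \<Longrightarrow> \<tau> d = 0"
proof -
  obtain T where T: "openin P T" "W = T \<inter> characters B"
    using W unfolding character_space_def openin_subtopology by blast
  have \<sigma>c: "\<sigma> \<in> characters B" "\<sigma> \<in> T" using \<sigma> T by auto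
  obtain U where U': "finite {i \<in> B. U i \<noteq> topspace (euclidean :: complex topology)}"
    "\<forall>i\<in>B. openin euclidean (U i)" and U34: "\<sigma> \<in> PiE B U" "PiE B U \<subseteq> T"
    using bspec[OF T(1)[unfolded openin_product_topology_alt] \<sigma>c(2)] by (elim exE conjE)
  have U: "finite {i \<in> B. U i \<noteq> (UNIV :: complex set)}" "\<And>i. i \<in> B \<Longrightarrow> open (U i)"
    "\<sigma> \<in> PiE B U" "PiE B U \<subseteq> T"
    using U' U34 by simp_all
  have "\<exists>d\<in>B. \<sigma> d \<noteq> 0 \<and> (\<forall>\<tau>\<in>characters B. (\<exists>i\<in>F. \<tau> i \<notin> U i) \<longrightarrow> \<tau> d = 0)"
    if "finite F" "F \<subseteq> B" for F
    using that
  proof (induction F rule: finite_induct)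
    case empty
    then show ?case using character_1[OF \<sigma>c(1)] by (intro bexI[of _ 1]) auto
  next
    case (insert i F)
    then obtain d where d: "d \<in> B" "\<sigma> d \<noteq> 0"
      "\<And>\<tau>. \<tau> \<in> characters B \<Longrightarrow> \<exists>i\<in>F. \<tau> i \<notin> U i \<Longrightarrow> \<tau> d = 0" by blast
    have i: "i \<in> B" using insert by simp
    then have "\<sigma> i \<in> U i" using U(3) by (rule PiE_mem[rotated])
    then obtain d' where d': "d' \<in> B" "\<sigma> d' \<noteq> 0"
      "\<And>\<tau>. \<tau> \<in> characters B \<Longrightarrow> \<tau> i \<notin> U i \<Longrightarrow> \<tau> d' = 0"
      using bump_coordinate[OF \<sigma>c(1) i U(2)[OF i]] by blast
    show ?case
    proof (intro bexI[of _ "d * d'"] conjI ballI impI)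
      show "\<sigma> (d * d') \<noteq> 0" using d d' by (simp add: character_mult[OF \<sigma>c(1)])
      fix \<tau> assume \<tau>: "\<tau> \<in> characters B" "\<exists>j\<in>insert i F. \<tau> j \<notin> U j"
      then have "\<tau> d = 0 \<or> \<tau> d' = 0" using d(3) d'(3) by blast
      then show "\<tau> (d * d') = 0" using d(1) d'(1) by (auto simp: character_mult[OF \<tau>(1)])
    qed (use d d' in simp)
  qed
  from this[OF U(1)] obtain d where d: "d \<in> B" "\<sigma> d \<noteq> 0"
    "\<And>\<tau>. \<tau> \<in> characters B \<Longrightarrow> \<exists>i\<in>{i \<in> B. U i \<noteq> UNIV}. \<tau> i \<notin> U i \<Longrightarrow> \<tau> d = 0"
    by auto
  show ?thesis
  proof (rule that[OF d(1,2)])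
    fix \<tau> assume \<tau>: "\<tau> \<in> characters B - W"
    then have "\<tau> \<notin> PiE B U" "\<tau> \<in> extensional B" using U(4) T(2) by (auto simp: characters_def)
    then obtain i where "i \<in> B" "\<tau> i \<notin> U i" by (auto simp: PiE_def Pi_def)
    then show "\<tau> d = 0" using \<tau> by (intro d(3)) auto
  qed
qed

text \<open>
  The characters at which the partial homeomorphism of the spectrum induced by \<open>v\<close>,
  \<open>\<sigma> \<mapsto> \<sigma>(v\<^sup>* \<cdot> v) / \<sigma>(v\<^sup>* v)\<close>, acts trivially or is undefined.
\<close>

definition fixed_characters :: "'a \<Rightarrow> ('a \<Rightarrow> complex) set" where
  "fixed_characters v = {\<sigma> \<in> characters B. \<forall>d\<in>B. \<sigma> d * \<sigma> (star v * v) = \<sigma> (star v * d * v)}"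

section \<open>Normalizers and the values of extensions on them\<close>

lemma
  assumes "v \<in> normalizers B" "d \<in> B"
  shows normalizer_star_mult: "star v * d * v \<in> B" and normalizer_mult_star: "v * d * star v \<in> B"
  using assms by (auto simp: normalizers_def)

lemma normalizer_star_v: "v \<in> normalizers B \<Longrightarrow> star v * v \<in> B"
  using normalizer_star_mult[of v 1] by simp

lemma normalizer_v_star: "v \<in> normalizers B \<Longrightarrow> v * star v \<in> B"
  using normalizer_mult_star[of v 1] by simp

lemma closedin_fixed_characters:
  assumes v: "v \<in> normalizers B"
  shows "closedin (character_space B) (fixed_characters v)"
  unfolding fixed_characters_def topspace_character_space[symmetric]
  by (intro closedin_Ball closedin_eq_complex continuous_map_mult_complex continuous_evaluation
      normalizer_star_mult normalizer_star_v v)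

text \<open>\<open>d\<close> commutes with \<open>v * star v\<close>, so
  \<open>d * v * (star v * v)\<close> equals \<open>v * (star v * d * v)\<close>. Multiplicativity
  of \<phi> against \<open>B\<close> turns this into two different multiples of \<phi>(v).\<close>

lemma state_vanishes_off_fixed_characters:
  assumes v: "v \<in> normalizers B" and \<sigma>: "\<sigma> \<in> characters B - fixed_characters v"
    and \<phi>: "state \<phi>" "\<And>d. d \<in> B \<Longrightarrow> \<phi> d = \<sigma> d"
  shows "\<phi> v = 0"
proof -
  have \<sigma>c: "\<sigma> \<in> characters B" using \<sigma> by simp
  obtain d where d: "d \<in> B" "\<sigma> d * \<sigma> (star v * v) \<noteq> \<sigma> (star v * d * v)"
    using \<sigma> by (auto simp: fixed_characters_def)
  have "d * (v * (star v * v)) = v * (star v * d * v)"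
    using commute[OF d(1) normalizer_v_star[OF v]] by (simp add: mult.assoc[symmetric])
  then have "\<phi> (d * (v * (star v * v))) = \<phi> (v * (star v * d * v))" by (rule arg_cong)
  then have "\<sigma> d * (\<phi> v * \<sigma> (star v * v)) = \<phi> v * \<sigma> (star v * d * v)"
    by (simp only: state_mult_left[OF \<phi>(1) \<sigma>c \<phi>(2) d(1)]
        state_mult_right[OF \<phi>(1) \<sigma>c \<phi>(2) normalizer_star_v[OF v]]
        state_mult_right[OF \<phi>(1) \<sigma>c \<phi>(2) normalizer_star_mult[OF v d(1)]])
  then have "\<phi> v * (\<sigma> d * \<sigma> (star v * v) - \<sigma> (star v * d * v)) = 0"
    by (simp add: algebra_simps)
  then show ?thesis using d(2) by simp
qed

text \<open>The commutator \<open>x\<close> need not lie in \<open>B\<close>, but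
  \<open>star x * x\<close> does. At a fixed character each factor \<open>star v * c * v\<close>
  evaluates to the value at \<open>c\<close> times that at \<open>star v * v\<close>, and the four
  terms cancel; at any other character every term vanishes with \<open>d\<close>.\<close>

lemma commutes_if_supported_in_fixed_characters:
  assumes v: "v \<in> normalizers B" and d: "d \<in> B"
    and supp: "\<And>\<tau>. \<tau> \<in> characters B - fixed_characters v \<Longrightarrow> \<tau> d = 0" and e: "e \<in> B"
  shows "e * (v * d) = (v * d) * e"
proof -
  define x where "x = e * (v * d) - (v * d) * e"
  have B: "star v * c * v \<in> B" if "c \<in> B" for c using normalizer_star_mult[OF v that] .
  let ?a = "star d * (star v * (star e * e) * v) * d"
  let ?b = "star d * (star v * star e * v) * (d * e)"
  let ?c = "(star e * star d) * (star v * e * v) * d"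
  \<comment> \<open>The unit is kept in the middle so that all four terms have the shape
    \<open>p * (star v * c * v) * q\<close> required by \<open>m3\<close>.\<close>
  let ?f = "(star e * star d) * (star v * 1 * v) * (d * e)"
  have B4: "?a \<in> B" "?b \<in> B" "?c \<in> B" "?f \<in> B" using d e by (simp_all add: B normalizer_star_v[OF v])
  have xx: "star x * x = (?a - ?b) - (?c - ?f)"
    by (simp add: x_def star_simps algebra_simps)
  have "star x * x = 0"
  proof (rule eq_0_if_characters)
    show "star x * x \<in> B" unfolding xx using B4 by (intro diff)
    show "star (star x * x) = star x * x" by (simp add: star_simps)
    fix \<tau> assume \<tau>: "\<tau> \<in> characters B"
    have \<tau>xx: "\<tau> (star x * x) = (\<tau> ?a - \<tau> ?b) - (\<tau> ?c - \<tau> ?f)"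
      unfolding xx using B4 by (simp only: character_diff[OF \<tau>] diff)
    have ds: "star d \<in> B" "star e \<in> B" "star e * star d \<in> B" "d * e \<in> B" "star e * e \<in> B"
      using d e by simp_all
    have m3: "\<tau> (p * (star v * c * v) * q) = \<tau> p * \<tau> (star v * c * v) * \<tau> q"
      if "p \<in> B" "c \<in> B" "q \<in> B" for p c q
      using that B[OF that(2)] by (simp only: character_mult[OF \<tau>] mult)
    show "\<tau> (star x * x) = 0"
    proof (cases "\<tau> \<in> fixed_characters v")
      case True
      then have fx: "\<tau> (star v * c * v) = \<tau> c * \<tau> (star v * v)" if "c \<in> B" for c
        using that by (simp add: fixed_characters_def)
      show ?thesis
        unfolding \<tau>xx m3[OF ds(1,5) d] m3[OF ds(1,2,4)] m3[OF ds(3) e d] m3[OF ds(3) one ds(4)]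
          fx[OF ds(5)] fx[OF ds(2)] fx[OF e] fx[OF one]
        using d e ds by (simp add: character_mult[OF \<tau>] character_1[OF \<tau>] algebra_simps)
    next
      case False
      then have "\<tau> d = 0" using supp \<tau> by simp
      then show ?thesis
        unfolding \<tau>xx m3[OF ds(1,5) d] m3[OF ds(1,2,4)] m3[OF ds(3) e d] m3[OF ds(3) one ds(4)]
        using d e by (simp add: character_mult[OF \<tau>])
    qed
  qed
  then have "norm x = 0" using cstar_identity[of x] by simp
  then show ?thesis by (simp add: x_def)
qed

text \<open>At interior points the bump \<open>d\<close> is supported where the commutation lemma
  applies, so both extensions agree at \<open>v * d\<close>, and the nonzero factor \<sigma>(d)
  cancels.\<close>

lemma states_agree_on_normalizer:
  assumes masa: "masa_inclusion B" and v: "v \<in> normalizers B"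
    and \<sigma>: "\<sigma> \<in> characters B" "\<sigma> \<notin> fixed_characters v - character_space B interior_of fixed_characters v"
    and \<phi>: "state \<phi>" "\<And>d. d \<in> B \<Longrightarrow> \<phi> d = \<sigma> d" and \<psi>: "state \<psi>" "\<And>d. d \<in> B \<Longrightarrow> \<psi> d = \<sigma> d"
  shows "\<phi> v = \<psi> v"
proof (cases "\<sigma> \<in> fixed_characters v")
  case True
  then have int: "\<sigma> \<in> character_space B interior_of fixed_characters v" using \<sigma>(2) by simp
  obtain d where d: "d \<in> B" "\<sigma> d \<noteq> 0"
    "\<And>\<tau>. \<tau> \<in> characters B - character_space B interior_of fixed_characters v \<Longrightarrow> \<tau> d = 0"
    using bump[OF openin_interior_of int] by blast
  have supp: "\<tau> d = 0" if "\<tau> \<in> characters B - fixed_characters v" for \<tau>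
    using that d(3)[of \<tau>] interior_of_subset[of "character_space B" "fixed_characters v"] by blast
  have "v * d \<in> B"
  proof (rule masa_commutant[OF masa])
    show "e * (v * d) = v * d * e" if "e \<in> B" for e
      by (rule commutes_if_supported_in_fixed_characters[OF v d(1) _ that]) (rule supp)
  qed
  then have "\<phi> (v * d) = \<psi> (v * d)" using \<phi> \<psi> by simp
  then have "\<phi> v * \<sigma> d = \<psi> v * \<sigma> d"
    by (simp only: state_mult_right[OF \<phi>(1) \<sigma>(1) \<phi>(2) d(1)] state_mult_right[OF \<psi>(1) \<sigma>(1) \<psi>(2) d(1)])
  then show ?thesis using d(2) by simp
next
  case False
  then have "\<phi> v = 0" "\<psi> v = 0"
    using state_vanishes_off_fixed_characters[OF v] \<sigma>(1) \<phi> \<psi> by blast+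
  then show ?thesis by simp
qed

text \<open>The set where two extensions agree is closed by contractivity of states, and it is a
  bimodule because both extensions pull out the same scalars \<sigma>(d). Agreement on
  \<open>N\<close> therefore spreads to everything \<open>N\<close> generates.\<close>

lemma unique_extension_if_regular:
  assumes masa: "masa_inclusion B" and N: "N \<subseteq> normalizers B"
    and gen: "closed_bimodule_generated B N = UNIV"
    and \<sigma>: "\<sigma> \<in> characters B"
      "\<And>v. v \<in> N \<Longrightarrow> \<sigma> \<notin> fixed_characters v - character_space B interior_of fixed_characters v"
  shows "\<sigma> \<in> unique_extension_characters B"
proof -
  have "\<phi> = \<psi>" if \<phi>: "state \<phi>" "\<forall>d\<in>B. \<phi> d = \<sigma> d" and \<psi>: "state \<psi>" "\<forall>d\<in>B. \<psi> d = \<sigma> d" for \<phi> \<psi>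
  proof -
    define M where "M = {x. \<phi> x = \<psi> x}"
    have \<phi>': "\<And>d. d \<in> B \<Longrightarrow> \<phi> d = \<sigma> d" and \<psi>': "\<And>d. d \<in> B \<Longrightarrow> \<psi> d = \<sigma> d" using \<phi> \<psi> by auto
    have "closed M" unfolding M_def
      by (intro closed_Collect_eq linear_continuous_on bounded_linear_state \<phi>(1) \<psi>(1))
    moreover have "csubspace M"
    proof -
      have "\<phi> 0 = \<psi> 0" using \<phi>'[OF zero] \<psi>'[OF zero] by simp
      then show ?thesis unfolding scaleC.subspace_def M_def
        by (simp add: state_add[OF \<phi>(1)] state_add[OF \<psi>(1)] state_scaleC[OF \<phi>(1)] state_scaleC[OF \<psi>(1)])
    qed
    then have "sub_bimodule B M" unfolding sub_bimodule_def M_def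
      by (simp add: state_mult_left[OF \<phi>(1) \<sigma>(1) \<phi>'] state_mult_left[OF \<psi>(1) \<sigma>(1) \<psi>']
          state_mult_right[OF \<phi>(1) \<sigma>(1) \<phi>'] state_mult_right[OF \<psi>(1) \<sigma>(1) \<psi>'])
    moreover have "N \<subseteq> M"
      using states_agree_on_normalizer[OF masa _ \<sigma>(1) \<sigma>(2) \<phi>(1) \<phi>' \<psi>(1) \<psi>'] N
      by (auto simp: M_def)
    ultimately have "closed_bimodule_generated B N \<subseteq> M"
      unfolding closed_bimodule_generated_def by (intro hull_minimal) simp_all
    then show ?thesis using gen by (auto simp: M_def)
  qed
  moreover obtain \<phi> where "state \<phi>" "\<And>d. d \<in> B \<Longrightarrow> \<phi> d = \<sigma> d"
    using state_extension[OF \<sigma>(1)] by blast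
  ultimately show ?thesis unfolding unique_extension_characters_def using \<sigma>(1) by blast
qed

end

section \<open>The Baire category argument\<close>

lemma interior_of_diff_interior_of: "X interior_of (S - X interior_of S) = {}"
proof -
  have "X interior_of (S - X interior_of S) \<subseteq> X interior_of S"
    by (intro interior_of_mono) auto
  moreover have "X interior_of (S - X interior_of S) \<subseteq> S - X interior_of S"
    by (rule interior_of_subset)
  ultimately show ?thesis by blast
qed

theorem theorem3p8:
  fixes D N :: "'a::cstar_algebra set"
  assumes "regular_masa_inclusion D"
    and "N \<subseteq> normalizers D"
    and "countable N"
    and "closed_bimodule_generated D N = UNIV"
  shows "character_space D closure_of unique_extension_characters D = topspace (character_space D)"
proof -
  have masa: "masa_inclusion D" using assms(1) by (simp add: regular_masa_inclusion_def)
  interpret abelian_inclusion D using masa by unfold_locales (simp add: masa_inclusion_def)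
  let ?X = "character_space D"
  let ?bad = "\<lambda>v. fixed_characters v - ?X interior_of fixed_characters v"
  have meagre: "?X interior_of \<Union>(?bad ` N) = {}"
  proof (rule Baire_category_alt)
    show "completely_metrizable_space ?X \<or> locally_compact_space ?X \<and> regular_space ?X"
      using compact_character_space Hausdorff_character_space
      by (simp add: compact_imp_locally_compact_space compact_Hausdorff_imp_regular_space)
    show "countable (?bad ` N)" using assms(3) by simp
    fix T assume "T \<in> ?bad ` N"
    then obtain v where v: "v \<in> N" "T = ?bad v" by blast
    then show "closedin ?X T \<and> ?X interior_of T = {}"
      using assms(2) closedin_fixed_characters[of v]
      by (auto simp: interior_of_diff_interior_of intro!: closedin_diff)
  qed
  have "topspace ?X - unique_extension_characters D \<subseteq> \<Union>(?bad ` N)"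
    using unique_extension_if_regular[OF masa assms(2,4)] unfolding topspace_character_space by blast
  then have "?X interior_of (topspace ?X - unique_extension_characters D) \<subseteq> {}"
    unfolding meagre[symmetric] by (rule interior_of_mono)
  then show ?thesis by (simp add: closure_of_interior_of)
qed

end
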